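(* Let $\delta > \frac{1}{2}$. Steiner Forest admits a polynomial-time approximation scheme on pairwise $\delta$-dense instances. On pairwise $\delta$-dense instances without Steiner nodes, an optimal solution can be found in polynomial time.
   Context: An instance of Steiner Forest consists of a graph $G$ and pairwise disjoint terminal sets $T_1,\dots,T_k$; the goal is a minimum-size (minimum number of edges) forest in $G$ such that all terminals of each $T_i$ lie in the same connected component. Nodes in $S = V(G)\setminus (T_1\cup\dots\cup T_k)$ are Steiner nodes. An instance $(G;T_1,\dots,T_k)$ is pairwise $\delta$-dense if each terminal $t\in T_i$ is adjacent to at least $\delta|T_j|$ nodes in $T_j$ and at least $\delta|S|$ nodes in $S$, for every $i = 1,\dots,k$ and $j\neq i$. *)

theory Defs
  imports Complex_Main "HOL-Library.Log_Nat" "HOL-Computational_Algebra.Polynomial"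
begin

section \<open>Steiner Forest\<close>

record sf_inst =
  verts :: "nat set"
  edges :: "nat set set"
  terminals :: "nat set list"

definition sf_instance :: "sf_inst \<Rightarrow> bool" where
  "sf_instance I \<longleftrightarrow>
     finite (verts I) \<and>
     (\<forall>e\<in>edges I. e \<subseteq> verts I \<and> card e = 2) \<and>
     (\<forall>T\<in>set (terminals I). T \<subseteq> verts I) \<and>
     (\<forall>i<length (terminals I). \<forall>j<length (terminals I).
        i \<noteq> j \<longrightarrow> terminals I ! i \<inter> terminals I ! j = {})"

definition steiner_nodes :: "sf_inst \<Rightarrow> nat set" where
  "steiner_nodes I = verts I - \<Union>(set (terminals I))"

definition same_component :: "nat set set \<Rightarrow> nat \<Rightarrow> nat \<Rightarrow> bool" where
  "same_component F u v \<longleftrightarrow> (u, v) \<in> {(a, b). {a, b} \<in> F}\<^sup>*"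

definition cycle :: "nat set set \<Rightarrow> nat list \<Rightarrow> bool" where
  "cycle F c \<longleftrightarrow> length c \<ge> 3 \<and> distinct c \<and>
     (\<forall>i<length c. {c ! i, c ! (Suc i mod length c)} \<in> F)"

definition forest :: "nat set set \<Rightarrow> bool" where
  "forest F \<longleftrightarrow> (\<nexists>c. cycle F c)"

definition steiner_forest :: "sf_inst \<Rightarrow> nat set set \<Rightarrow> bool" where
  "steiner_forest I F \<longleftrightarrow> F \<subseteq> edges I \<and> forest F \<and>
     (\<forall>T\<in>set (terminals I). \<forall>u\<in>T. \<forall>v\<in>T. same_component F u v)"

definition feasible :: "sf_inst \<Rightarrow> bool" where
  "feasible I \<longleftrightarrow> (\<exists>F. steiner_forest I F)"

definition opt_size :: "sf_inst \<Rightarrow> nat" where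
  "opt_size I = Min (card ` {F. steiner_forest I F})"

definition pairwise_dense :: "real \<Rightarrow> sf_inst \<Rightarrow> bool" where
  "pairwise_dense \<delta> I \<longleftrightarrow>
     (\<forall>i<length (terminals I). \<forall>t\<in>terminals I ! i.
        (\<forall>j<length (terminals I). j \<noteq> i \<longrightarrow>
           real (card {v \<in> terminals I ! j. {t, v} \<in> edges I}) \<ge> \<delta> * real (card (terminals I ! j))) \<and>
        real (card {v \<in> steiner_nodes I. {t, v} \<in> edges I}) \<ge> \<delta> * real (card (steiner_nodes I)))"

section \<open>Model of computation\<close>

text \<open>
  Programs are written in a first-order language of recursive functions over binary trees
  whose leaves are natural numbers. Each evaluated expression node costs one unit. A step allocates at
  most one cell, and the arithmetic operations (there is no multiplication) lengthen numbers by
  at most one bit, so \<open>t\<close> steps can be simulated by a Turing machine in time polynomial in \<open>t\<close>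
  and the size of the input.
\<close>

datatype val = NatV nat | PairV val val

datatype arith = Plus | Minus | Less | Equal

datatype exp =
    Var nat
  | Lit nat
  | Arith arith exp exp
  | MkPair exp exp
  | Fst exp
  | Snd exp
  | IsPair exp
  | IfNonzero exp exp exp
  | LetIn exp exp
  | Call nat "exp list"

text \<open>
  A program is the list of its function bodies. Variables are de Bruijn indices; a body is
  evaluated in the environment consisting of the arguments of the call.
\<close>

type_synonym program = "exp list"

fun arith_op :: "arith \<Rightarrow> nat \<Rightarrow> nat \<Rightarrow> nat" where
  "arith_op Plus m n = m + n"
| "arith_op Minus m n = m - n"
| "arith_op Less m n = (if m < n then 1 else 0)"
| "arith_op Equal m n = (if m = n then 1 else 0)"

inductive eval :: "program \<Rightarrow> val list \<Rightarrow> exp \<Rightarrow> val \<Rightarrow> nat \<Rightarrow> bool"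
  and evals :: "program \<Rightarrow> val list \<Rightarrow> exp list \<Rightarrow> val list \<Rightarrow> nat \<Rightarrow> bool"
  for p :: program where
  eval_Var: "i < length env \<Longrightarrow> eval p env (Var i) (env ! i) 1"
| eval_Lit: "eval p env (Lit n) (NatV n) 1"
| eval_Arith: "eval p env a (NatV m) s \<Longrightarrow> eval p env b (NatV n) t \<Longrightarrow>
    eval p env (Arith f a b) (NatV (arith_op f m n)) (s + t + 1)"
| eval_MkPair: "eval p env a v s \<Longrightarrow> eval p env b w t \<Longrightarrow>
    eval p env (MkPair a b) (PairV v w) (s + t + 1)"
| eval_Fst: "eval p env a (PairV v w) s \<Longrightarrow> eval p env (Fst a) v (s + 1)"
| eval_Snd: "eval p env a (PairV v w) s \<Longrightarrow> eval p env (Snd a) w (s + 1)"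
| eval_IsPair_pair: "eval p env a (PairV v w) s \<Longrightarrow> eval p env (IsPair a) (NatV 1) (s + 1)"
| eval_IsPair_nat: "eval p env a (NatV n) s \<Longrightarrow> eval p env (IsPair a) (NatV 0) (s + 1)"
| eval_If_nonzero: "eval p env a (NatV n) s \<Longrightarrow> n \<noteq> 0 \<Longrightarrow> eval p env b v t \<Longrightarrow>
    eval p env (IfNonzero a b c) v (s + t + 1)"
| eval_If_zero: "eval p env a (NatV 0) s \<Longrightarrow> eval p env c v t \<Longrightarrow>
    eval p env (IfNonzero a b c) v (s + t + 1)"
| eval_Let: "eval p env a v s \<Longrightarrow> eval p (v # env) b w t \<Longrightarrow>
    eval p env (LetIn a b) w (s + t + 1)"
| eval_Call: "evals p env as vs s \<Longrightarrow> f < length p \<Longrightarrow> eval p vs (p ! f) w t \<Longrightarrow>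
    eval p env (Call f as) w (s + t + 1)"
| evals_Nil: "evals p env [] [] 0"
| evals_Cons: "eval p env a v s \<Longrightarrow> evals p env as vs t \<Longrightarrow>
    evals p env (a # as) (v # vs) (s + t)"

inductive_cases eval_VarE: "eval p env (Var i) v t"
inductive_cases eval_LitE: "eval p env (Lit n) v t"
inductive_cases eval_ArithE: "eval p env (Arith f a b) v t"
inductive_cases eval_MkPairE: "eval p env (MkPair a b) v t"
inductive_cases eval_FstE: "eval p env (Fst a) v t"
inductive_cases eval_SndE: "eval p env (Snd a) v t"
inductive_cases eval_IsPairE: "eval p env (IsPair a) v t"
inductive_cases eval_IfE: "eval p env (IfNonzero a b c) v t"
inductive_cases eval_LetE: "eval p env (LetIn a b) v t"
inductive_cases eval_CallE: "eval p env (Call f as) v t"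
inductive_cases evals_NilE: "evals p env [] vs t"
inductive_cases evals_ConsE: "evals p env (a # as) vs t"

lemma eval_deterministic:
  "eval p env e v t \<Longrightarrow> eval p env e v' t' \<Longrightarrow> v' = v \<and> t' = t"
  "evals p env es vs t \<Longrightarrow> evals p env es vs' t' \<Longrightarrow> vs' = vs \<and> t' = t"
proof (induction arbitrary: v' t' and vs' t' rule: eval_evals.inducts)
  case (eval_Var i env)
  from eval_Var.prems show ?case by (rule eval_VarE) simp
next
  case (eval_Lit env n)
  from eval_Lit.prems show ?case by (rule eval_LitE) simp
next
  case (eval_Arith env a m s b n t f)
  from eval_Arith.prems show ?case
    by (rule eval_ArithE) (auto dest!: eval_Arith.IH(2,4))
next
  case (eval_MkPair env a v s b w t)
  from eval_MkPair.prems show ?case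
    by (rule eval_MkPairE) (auto dest!: eval_MkPair.IH(2,4))
next
  case (eval_Fst env a v w s)
  from eval_Fst.prems show ?case
    by (rule eval_FstE) (auto dest!: eval_Fst.IH(2))
next
  case (eval_Snd env a v w s)
  from eval_Snd.prems show ?case
    by (rule eval_SndE) (auto dest!: eval_Snd.IH(2))
next
  case (eval_IsPair_pair env a v w s)
  from eval_IsPair_pair.prems show ?case
    by (rule eval_IsPairE) (auto dest!: eval_IsPair_pair.IH(2))
next
  case (eval_IsPair_nat env a n s)
  from eval_IsPair_nat.prems show ?case
    by (rule eval_IsPairE) (auto dest!: eval_IsPair_nat.IH(2))
next
  case (eval_If_nonzero env a n s b v t c)
  from eval_If_nonzero.prems show ?case
    by (rule eval_IfE) (use eval_If_nonzero.hyps in \<open>auto dest!: eval_If_nonzero.IH(2,4)\<close>)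
next
  case (eval_If_zero env a s c v t b)
  from eval_If_zero.prems show ?case
    by (rule eval_IfE) (auto dest!: eval_If_zero.IH(2,4))
next
  case (eval_Let env a v s b w t)
  from eval_Let.prems show ?case
    by (rule eval_LetE) (auto dest!: eval_Let.IH(2,4))
next
  case (eval_Call env as vs s f w t)
  from eval_Call.prems show ?case
    by (rule eval_CallE) (auto dest!: eval_Call.IH(2,5))
next
  case (evals_Nil env)
  from evals_Nil.prems show ?case by (rule evals_NilE) simp
next
  case (evals_Cons env a v s as vs t)
  from evals_Cons.prems show ?case
    by (rule evals_ConsE) (auto dest!: evals_Cons.IH(2,4))
qed

fun val_size :: "val \<Rightarrow> nat" where
  "val_size (NatV n) = floorlog 2 n + 1"
| "val_size (PairV v w) = val_size v + val_size w + 1"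

text \<open>
  Subtrees may be shared during the evaluation, so a result can be much larger than the number
  of steps; the time for writing it out is therefore charged separately.
\<close>

definition runs :: "program \<Rightarrow> val \<Rightarrow> val \<Rightarrow> nat \<Rightarrow> bool" where
  "runs p x y t \<longleftrightarrow> p \<noteq> [] \<and> (\<exists>s. eval p [x] (p ! 0) y s \<and> t = s + val_size y)"

section \<open>Encodings\<close>

fun list_val :: "('a \<Rightarrow> val) \<Rightarrow> 'a list \<Rightarrow> val" where
  "list_val f [] = NatV 0"
| "list_val f (x # xs) = PairV (f x) (list_val f xs)"

definition lists_set :: "'a list \<Rightarrow> 'a set \<Rightarrow> bool" where
  "lists_set xs A \<longleftrightarrow> distinct xs \<and> set xs = A"

definition edges_encoding :: "val \<Rightarrow> nat set set \<Rightarrow> bool" where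
  "edges_encoding x F \<longleftrightarrow>
     (\<exists>es. lists_set (map (\<lambda>(u, v). {u, v}) es) F \<and>
           x = list_val (\<lambda>(u, v). PairV (NatV u) (NatV v)) es)"

definition instance_encoding :: "val \<Rightarrow> sf_inst \<Rightarrow> bool" where
  "instance_encoding x I \<longleftrightarrow>
     (\<exists>vs y ts. lists_set vs (verts I) \<and> edges_encoding y (edges I) \<and>
        list_all2 lists_set ts (terminals I) \<and>
        x = PairV (list_val NatV vs) (PairV y (list_val (list_val NatV) ts)))"

section \<open>Polynomial-time (approximate) solvability on a class of instances\<close>

text \<open>
  As usual for problems on a restricted class, nothing is required of a program on inputs outside
  the class, nor of its answer on instances that have no solution.
\<close>

definition polytime_solvable_on :: "(sf_inst \<Rightarrow> bool) \<Rightarrow> bool" where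
  "polytime_solvable_on C \<longleftrightarrow>
     (\<exists>p :: program. \<exists>b :: nat poly. \<forall>I x.
        sf_instance I \<and> C I \<and> instance_encoding x I \<longrightarrow>
        (\<exists>y t. runs p x y t \<and> t \<le> poly b (val_size x) \<and>
           (feasible I \<longrightarrow>
              (\<exists>F. edges_encoding y F \<and> steiner_forest I F \<and> card F = opt_size I))))"

text \<open>
  A single program receives the error parameter \<open>\<epsilon> = m / n\<close> together with the instance; the
  polynomial may depend on \<open>\<epsilon>\<close>.
\<close>

definition ptas_on :: "(sf_inst \<Rightarrow> bool) \<Rightarrow> bool" where
  "ptas_on C \<longleftrightarrow>
     (\<exists>p :: program. \<forall>m n :: nat. m > 0 \<and> n > 0 \<longrightarrow> (\<exists>b :: nat poly. \<forall>I x.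
        sf_instance I \<and> C I \<and> instance_encoding x I \<longrightarrow>
        (\<exists>y t. runs p (PairV (PairV (NatV m) (NatV n)) x) y t \<and> t \<le> poly b (val_size x) \<and>
           (feasible I \<longrightarrow>
              (\<exists>F. edges_encoding y F \<and> steiner_forest I F \<and>
                   real (card F) \<le> (1 + real m / real n) * real (opt_size I))))))"

end

theory Submission
  imports Defs
begin

text \<open>
  Density above 1/2 makes any two terminals of one set have a common neighbour in every other
  nonempty terminal set, so a union of at least two terminal sets always induces a connected
  subgraph. Hence a solution never needs Steiner nodes when there are two or more nonempty sets: it
  suffices to keep the sets that are connected by themselves and to join the others in pairs (an odd
  one joins any group). Counting the components of an arbitrary solution shows that this is
  optimal.

  There remains a single terminal set \<open>T\<close> that is not connected by itself. Then
  some Steiner node is adjacent to half of any given set of terminals, so \<open>r\<close> Steiner nodes dominate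
  all but \<open>|T| / 2 ^ r\<close> terminals, and each undominated terminal is attached at the cost of one more
  Steiner node. For large \<open>T\<close> this is within a factor \<open>1 + \<epsilon>\<close> of the lower bound
  \<open>|T| - 1\<close>; for small \<open>T\<close> an optimal tree has boundedly many Steiner nodes. Both cases are covered by
  trying all sets of boundedly many Steiner nodes.
\<close>

section \<open>Components and forests\<close>

text \<open>Density is used through strict majorities: since \<delta> > 1/2, a terminal sees more
  than half of every other nonempty terminal set and of the Steiner nodes. Two majorities of one set
  meet, and averaging over the Steiner nodes yields one that sees half of any set of terminals. A
  forest has |V| minus its number of components many edges. Hence optimality of the grouping follows
  by bounding the components of an arbitrary solution from above and those of the computed one from
  below. Attaching a terminal through a common Steiner neighbour costs two edges, whence the 2 in
  \<open>2 * |T| / 2 ^ r\<close>. The time bound is also due on infeasible instances, where nothing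
  is known about the answer. Therefore all states of the algorithm obey an invariant (acyclic,
  distinct input edges) that bounds the output by itself. Correctness is proved for functions on
  lists; the machine program is shown to compute the same functions within explicit costs. The
  degree of the polynomial is governed by the number \<open>200 * n * n\<close> of Steiner nodes
  that may be guessed, which yields ratio \<open>1 + 1 / n\<close>.\<close>

definition graph_on :: "nat set \<Rightarrow> nat set set \<Rightarrow> bool" where
  "graph_on V F \<longleftrightarrow> (\<forall>e\<in>F. e \<subseteq> V \<and> card e = 2)"

definition component :: "nat set \<Rightarrow> nat set set \<Rightarrow> nat \<Rightarrow> nat set" where
  "component V F v = {w \<in> V. same_component F v w}"

definition components :: "nat set \<Rightarrow> nat set set \<Rightarrow> nat set set" where
  "components V F = component V F ` V"

definition connected_on :: "nat set set \<Rightarrow> nat set \<Rightarrow> bool" where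
  "connected_on E W \<longleftrightarrow> (\<forall>u\<in>W. \<forall>v\<in>W. same_component {e \<in> E. e \<subseteq> W} u v)"

lemma same_component_refl [simp]: "same_component F u u"
  by (simp add: same_component_def)

lemma same_component_edge: "{u, v} \<in> F \<Longrightarrow> same_component F u v"
  by (auto simp: same_component_def)

lemma same_component_trans [trans]:
  "same_component F u v \<Longrightarrow> same_component F v w \<Longrightarrow> same_component F u w"
  by (auto simp: same_component_def)

lemma same_component_sym: "same_component F u v \<Longrightarrow> same_component F v u"
proof -
  have "sym {(a, b). {a, b} \<in> F}"
    by (auto simp: sym_def insert_commute)
  then show "same_component F u v \<Longrightarrow> same_component F v u"
    unfolding same_component_def by (meson sym_rtrancl symD)
qed

lemma same_component_euclid:
  "same_component F v a \<Longrightarrow> same_component F v b \<Longrightarrow> same_component F a b"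
  by (rule same_component_trans[OF same_component_sym])

lemma same_component_induct [consumes 1, case_names refl step]:
  assumes "same_component F u v" "P u"
    and "\<And>b c. same_component F u b \<Longrightarrow> {b, c} \<in> F \<Longrightarrow> P b \<Longrightarrow> P c"
  shows "P v"
  using assms(1) unfolding same_component_def
  by (induction rule: rtrancl_induct) (use assms(2,3) in \<open>auto simp: same_component_def\<close>)

lemma same_component_if_edges_connected:
  assumes "same_component F u v"
    and "\<And>a b. {a, b} \<in> F \<Longrightarrow> same_component F' a b"
  shows "same_component F' u v"
  using assms(1) by (induction rule: same_component_induct) (auto intro: same_component_trans assms(2))

lemma same_component_mono: "same_component F u v \<Longrightarrow> F \<subseteq> F' \<Longrightarrow> same_component F' u v"
  by (rule same_component_if_edges_connected) (auto intro: same_component_edge)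

lemma same_component_closed:
  assumes "same_component F u v" "u \<in> K" "\<And>a b. {a, b} \<in> F \<Longrightarrow> a \<in> K \<Longrightarrow> b \<in> K"
  shows "v \<in> K"
  using assms(1) by (induction rule: same_component_induct) (auto intro: assms(2,3))

text \<open>A walk can be shortened so that it crosses the new edge at most once, in one of two
  directions; this accounts for the three cases.\<close>

lemma same_component_insert:
  "same_component (insert {u, v} F) a b \<longleftrightarrow>
     same_component F a b \<or> same_component F a u \<and> same_component F v b \<or>
     same_component F a v \<and> same_component F u b" (is "?L \<longleftrightarrow> ?R b")
proof
  assume ?L
  then show "?R b"
  proof (induction rule: same_component_induct)
    case (step b c)
    show ?case
    proof (cases "{b, c} \<in> F")
      case True
      then show ?thesis using step.IH by (meson same_component_edge same_component_trans)
    next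
      case False
      then have "{b, c} = {u, v}" using step.hyps by auto
      then have "b = u \<and> c = v \<or> b = v \<and> c = u" by (auto simp: doubleton_eq_iff)
      then show ?thesis using step.IH
        by (meson same_component_refl same_component_trans)
    qed
  qed simp
next
  have "same_component (insert {u, v} F) u v" "same_component (insert {u, v} F) v u"
    by (auto intro: same_component_edge simp: insert_commute)
  moreover have "same_component F a b \<Longrightarrow> same_component (insert {u, v} F) a b" for a b
    by (erule same_component_mono) auto
  ultimately show "?R b \<Longrightarrow> ?L" by (meson same_component_trans)
qed

section \<open>Acyclicity and connectivity\<close>

lemma forest_subset: "forest F \<Longrightarrow> F' \<subseteq> F \<Longrightarrow> forest F'"
  unfolding forest_def cycle_def by (meson subsetD)

lemma forest_empty [simp]: "forest {}"
  unfolding forest_def cycle_def by (auto intro!: exI[of _ 0])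

text \<open>A cycle of the enlarged graph uses the new edge, and at one position only; the rest of
  the cycle would join \<open>u\<close> and \<open>v\<close> inside \<open>F\<close>.\<close>

lemma forest_insert:
  assumes "forest F" "\<not> same_component F u v"
  shows "forest (insert {u, v} F)"
  unfolding forest_def
proof
  assume "\<exists>c. cycle (insert {u, v} F) c"
  then obtain c where c: "cycle (insert {u, v} F) c" by blast
  let ?n = "length c"
  have n: "?n \<ge> 3" and dist: "distinct c"
    and ed: "\<And>i. i < ?n \<Longrightarrow> {c ! i, c ! (Suc i mod ?n)} \<in> insert {u, v} F"
    using c by (auto simp: cycle_def)
  have lt: "k mod ?n < ?n" for k using n by (intro mod_less_divisor) linarith
  obtain i where i: "i < ?n" "{c ! i, c ! (Suc i mod ?n)} = {u, v}"
  proof (rule ccontr)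
    assume "\<not> thesis"
    then have "cycle F c" using that n dist ed by (fastforce simp: cycle_def)
    then show False using assms(1) by (auto simp: forest_def)
  qed
  \<comment> \<open>Two positions carrying the same edge would be successors of each other, which
    forces length 2.\<close>
  have other: "{c ! j, c ! (Suc j mod ?n)} \<in> F" if j: "j < ?n" "j \<noteq> i" for j
  proof (rule ccontr)
    assume "{c ! j, c ! (Suc j mod ?n)} \<notin> F"
    then have "{c ! j, c ! (Suc j mod ?n)} = {c ! i, c ! (Suc i mod ?n)}"
      using ed[OF j(1)] i(2) by auto
    moreover have "c ! j \<noteq> c ! i" using dist j i by (simp add: nth_eq_iff_index_eq)
    ultimately have "c ! j = c ! (Suc i mod ?n)" "c ! i = c ! (Suc j mod ?n)"
      by (auto simp: doubleton_eq_iff)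
    then have "j = Suc i mod ?n" "i = Suc j mod ?n"
      using dist j(1) i(1) lt by (simp_all add: nth_eq_iff_index_eq)
    then show False using n i(1) j(1) by (auto simp: mod_Suc split: if_splits)
  qed
  \<comment> \<open>Walk around the cycle from the successor of position \<open>i\<close>; until the
    walk is back at \<open>i\<close> it avoids the edge at that position.\<close>
  have path: "same_component F (c ! (Suc i mod ?n)) (c ! ((Suc i + k) mod ?n))" if "k < ?n" for k
    using that
  proof (induction k)
    case (Suc k)
    let ?j = "(Suc i + k) mod ?n"
    have "?j \<noteq> i"
    proof
      assume "?j = i"
      then have "(Suc i + k) mod ?n = (i + 0) mod ?n" using i(1) by simp
      then have "(i + Suc k) mod ?n = (i + 0) mod ?n" by simp
      then have "Suc k mod ?n = 0 mod ?n" by (metis add.commute mod_0 mod_add_left_eq nat_mod_eq_iff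
            add_left_cancel mod_eq_dvd_iff_nat dvd_imp_mod_0 diff_add_inverse le_add1 add_0_right)
      then show False using Suc.prems by simp
    qed
    then have "{c ! ?j, c ! (Suc ?j mod ?n)} \<in> F" using other[of ?j] lt by blast
    moreover have "Suc ?j mod ?n = (Suc i + Suc k) mod ?n" by (simp add: mod_Suc_eq)
    ultimately show ?case using Suc by (metis same_component_edge same_component_trans Suc_lessD)
  qed simp
  have "Suc i + (?n - 1) = i + ?n" using n by linarith
  then have "(Suc i + (?n - 1)) mod ?n = i" using i(1) by simp
  then have "same_component F (c ! (Suc i mod ?n)) (c ! i)" using path[of "?n - 1"] n by simp
  then have "same_component F u v" using i(2) by (metis doubleton_eq_iff same_component_sym)
  then show False using assms(2) by simp
qed

text \<open>\<open>same_component\<close> is witnessed by walks, while \<open>cycle\<close> asks for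
  distinct vertices. When the walk returns to a vertex of the path built so far, the path is cut
  there.\<close>

lemma same_component_distinct_path:
  assumes "same_component F u v"
  shows "\<exists>c. c \<noteq> [] \<and> hd c = u \<and> last c = v \<and> distinct c \<and>
      (\<forall>i. Suc i < length c \<longrightarrow> {c ! i, c ! Suc i} \<in> F)"
  using assms
proof (induction rule: same_component_induct)
  case refl
  show ?case by (rule exI[of _ "[u]"]) simp
next
  case (step b d)
  then obtain c where c: "c \<noteq> []" "hd c = u" "last c = b" "distinct c"
    "\<And>i. Suc i < length c \<Longrightarrow> {c ! i, c ! Suc i} \<in> F" by blast
  show ?case
  proof (cases "d \<in> set c")
    case True
    then obtain j where j: "j < length c" "c ! j = d" by (auto simp: in_set_conv_nth)
    have "last (take (Suc j) c) = d" using j by (simp add: take_Suc_conv_app_nth)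
    then show ?thesis using c j by (intro exI[of _ "take (Suc j) c"]) (auto simp: hd_conv_nth)
next
    case False
    have "{(c @ [d]) ! i, (c @ [d]) ! Suc i} \<in> F" if "Suc i < length (c @ [d])" for i
    proof (cases "Suc i < length c")
      case True
      then show ?thesis using c(5)[of i] by (simp add: nth_append)
    next
      case f: False
      then have "i = length c - 1" "Suc i = length c" using that by auto
      then show ?thesis using step.hyps(2) c(1,3) by (simp add: nth_append last_conv_nth)
    qed
    then show ?thesis using c False by (intro exI[of _ "c @ [d]"]) auto
  qed
qed

text \<open>A repetition-free path from \<open>u\<close> to \<open>v\<close> would close to a cycle
  with the removed edge. Paths on one or two vertices are excluded by \<open>u \<noteq> v\<close>
  and by the removal of the edge.\<close>

lemma forest_edge_separates:
  assumes "forest F" "{u, v} \<in> F" "u \<noteq> v"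
  shows "\<not> same_component (F - {{u, v}}) u v"
proof
  assume "same_component (F - {{u, v}}) u v"
  then obtain c where c: "c \<noteq> []" "hd c = u" "last c = v" "distinct c"
    "\<And>i. Suc i < length c \<Longrightarrow> {c ! i, c ! Suc i} \<in> F - {{u, v}}"
    using same_component_distinct_path by metis
  have ends: "c ! 0 = u" "c ! (length c - 1) = v" using c by (auto simp: hd_conv_nth last_conv_nth)
  have "length c \<noteq> 0" "length c \<noteq> 1" using c(1) ends assms(3) by auto
  moreover have "length c \<noteq> 2" using c(5)[of 0] ends by auto
  ultimately have len: "length c \<ge> 3" by linarith
  have "{c ! i, c ! (Suc i mod length c)} \<in> F" if "i < length c" for i
  proof (cases "Suc i < length c")
    case True
    then show ?thesis using c(5)[of i] by simp
  next
    case False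
    then have "Suc i = length c" "i = length c - 1" using that by auto
    then show ?thesis using ends assms(2) by (simp add: insert_commute)
  qed
  then have "cycle F c" using len c(4) by (simp add: cycle_def)
  then show False using assms(1) by (auto simp: forest_def)
qed

section \<open>Counting components\<close>

lemma component_eq_iff:
  "w \<in> V \<Longrightarrow> component V F v = component V F w \<longleftrightarrow> same_component F v w"
  by (auto simp: component_def intro: same_component_trans same_component_sym)

text \<open>The two distinct classes of \<open>u\<close> and \<open>v\<close> merge into one; all
  other classes survive.\<close>

lemma card_components_insert:
  assumes "finite V" "u \<in> V" "v \<in> V" "\<not> same_component F u v"
  shows "card (components V F) = Suc (card (components V (insert {u, v} F)))"
proof -
  let ?C = "component V F" and ?F = "insert {u, v} F"
  let ?M = "?C u \<union> ?C v"
  have cl: "component V ?F a = (if a \<in> ?M then ?M else ?C a)" if "a \<in> V" for a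
    using that by (auto simp: component_def same_component_insert
        intro: same_component_trans same_component_sym)
  have ne: "?C u \<noteq> ?C v" using assms by (simp add: component_eq_iff)
  have self: "a \<in> V \<Longrightarrow> a \<in> ?C a" for a by (simp add: component_def)
  have "components V ?F = insert ?M (components V F - {?C u, ?C v})"
  proof (intro equalityI subsetI)
    fix K assume "K \<in> components V ?F"
    then obtain a where a: "a \<in> V" "K = component V ?F a" by (auto simp: components_def)
    show "K \<in> insert ?M (components V F - {?C u, ?C v})"
    proof (cases "a \<in> ?M")
      case False
      then have "?C a \<noteq> ?C u" "?C a \<noteq> ?C v" using self[OF a(1)] by auto
      then show ?thesis using a cl[OF a(1)] False by (auto simp: components_def)
    qed (use a cl in auto)
  next
    fix K assume K: "K \<in> insert ?M (components V F - {?C u, ?C v})"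
    show "K \<in> components V ?F"
    proof (cases "K = ?M")
      case True
      then have "K = component V ?F u" using cl[OF assms(2)] self[OF assms(2)] by simp
      then show ?thesis using assms(2) by (simp add: components_def)
    next
      case False
      then obtain a where a: "a \<in> V" "K = ?C a" "?C a \<noteq> ?C u" "?C a \<noteq> ?C v"
        using K by (auto simp: components_def)
      have "a \<notin> ?M"
        using a(3,4) component_eq_iff[OF a(1), of F] by (auto simp: component_def)
      then show ?thesis using a cl[OF a(1)] by (auto simp: components_def)
    qed
  qed
  moreover have "?M \<notin> components V F"
  proof
    assume "?M \<in> components V F"
    then obtain a where "a \<in> V" "?M = ?C a" by (auto simp: components_def)
    moreover have "u \<in> ?M" "v \<in> ?M" using self assms by auto
    ultimately have "same_component F a u" "same_component F a v" by (auto simp: component_def)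
    then show False using assms(4) by (meson same_component_sym same_component_trans)
  qed
  moreover have fin: "finite (components V F)" using assms(1) by (simp add: components_def)
  moreover have sub: "{?C u, ?C v} \<subseteq> components V F" using assms by (auto simp: components_def)
  moreover have two: "card {?C u, ?C v} = 2" using ne by simp
  moreover have "card (components V F) \<ge> 2" using card_mono[OF fin sub] two by simp
  ultimately show ?thesis by (simp add: card_Diff_subset)
qed

lemma graph_on_finite: "finite V \<Longrightarrow> graph_on V F \<Longrightarrow> finite F"
  by (rule finite_subset[of _ "Pow V"]) (auto simp: graph_on_def)

text \<open>Each edge of a forest joins two components of the remaining edges, so building
  \<open>F\<close> edge by edge loses one component per edge, starting from \<open>card V\<close>
  singletons.\<close>

lemma card_forest:
  assumes "finite V" "graph_on V F" "forest F"
  shows "card F + card (components V F) = card V"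
proof -
  have "finite F" using assms by (simp add: graph_on_finite)
  then show ?thesis using assms(2,3)
  proof (induction F rule: finite_induct)
    case empty
    have "component V {} v = {v}" if "v \<in> V" for v
      using that by (auto simp: component_def same_component_def)
    then have "components V {} = (\<lambda>v. {v}) ` V" by (auto simp: components_def)
    then show ?case by (simp add: card_image)
  next
    case (insert e F)
    then obtain u v where e: "e = {u, v}" "u \<noteq> v" "u \<in> V" "v \<in> V"
      by (auto simp: graph_on_def card_2_iff)
    have "\<not> same_component F u v"
      using forest_edge_separates[of "insert e F" u v] insert.hyps insert.prems e by simp
    then have "card (components V F) = Suc (card (components V (insert e F)))"
      using card_components_insert[OF assms(1) e(3,4)] e(1) by simp
    moreover have "card F + card (components V F) = card V"
      using insert by (auto simp: graph_on_def intro: forest_subset)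
    ultimately show ?case using insert.hyps by simp
  qed
qed

lemma card_forest_less:
  assumes "finite V" "V \<noteq> {}" "graph_on V F" "forest F"
  shows "card F < card V"
proof -
  have "card (components V F) > 0" using assms by (simp add: components_def card_gt_0_iff)
  then show ?thesis using card_forest[OF assms(1,3,4)] by linarith
qed

lemma card_tree:
  assumes "finite V" "V \<noteq> {}" "graph_on V F" "forest F"
    and "\<And>u v. u \<in> V \<Longrightarrow> v \<in> V \<Longrightarrow> same_component F u v"
  shows "Suc (card F) = card V"
proof -
  have "components V F = {V}"
    using assms(2,5) by (auto simp: components_def component_def)
  then show ?thesis using card_forest[OF assms(1,3,4)] by simp
qed

text \<open>Unconnected representatives lie in different components. Through
  \<open>card_forest\<close> this bounds the size of a forest from above.\<close>

lemma card_components_ge: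
  assumes "finite V" "R \<subseteq> V"
    and "\<And>u v. u \<in> R \<Longrightarrow> v \<in> R \<Longrightarrow> same_component F u v \<Longrightarrow> u = v"
  shows "card R \<le> card (components V F)"
proof (rule card_inj_on_le)
  show "inj_on (component V F) R"
    using assms(2,3) by (auto simp: inj_on_def component_eq_iff subset_iff)
qed (use assms in \<open>auto simp: components_def\<close>)

text \<open>The components partition \<open>V\<close>, so their weights add up. Through
  \<open>card_forest\<close> this bounds the size of a forest from below; weights allow for
  components shared by two sets of half the weight.\<close>

lemma card_components_le_weight:
  fixes w :: "nat \<Rightarrow> nat"
  assumes "finite V" and "\<And>v. v \<in> V \<Longrightarrow> m \<le> sum w (component V F v)"
  shows "m * card (components V F) \<le> sum w V"
proof -
  have fin: "finite (components V F)" using assms(1) by (simp add: components_def)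
  have "m * card (components V F) = (\<Sum>K\<in>components V F. m)" by simp
  also have "\<dots> \<le> (\<Sum>K\<in>components V F. sum w K)"
    by (rule sum_mono) (auto simp: components_def assms(2))
  also have "\<dots> = sum w (\<Union>(components V F))"
  proof (rule sum.Union_disjoint[symmetric, unfolded comp_def])
    show "\<forall>A\<in>components V F. finite A" using assms(1) by (auto simp: components_def component_def)
    show "\<forall>A\<in>components V F. \<forall>B\<in>components V F. A \<noteq> B \<longrightarrow> A \<inter> B = {}"
      by (auto simp: components_def component_def
          intro: same_component_trans same_component_sym; metis same_component_sym same_component_trans)
  qed
  also have "\<Union>(components V F) = V" by (auto simp: components_def component_def)
  finally show ?thesis .
qed

section \<open>Kruskal's algorithm with component labels\<close>

type_synonym edge_list = "(nat \<times> nat) list"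

definition uedges :: "edge_list \<Rightarrow> nat set set" where
  "uedges es = (\<lambda>(u, v). {u, v}) ` set es"

definition inside :: "nat list \<Rightarrow> edge_list \<Rightarrow> edge_list" where
  "inside xs es = filter (\<lambda>(u, v). u \<in> set xs \<and> v \<in> set xs) es"

text \<open>The default 0 may also be a genuine label. Lookups are trusted only for vertices with an
  entry, which \<open>kinv\<close> guarantees for all of \<open>vs\<close>.\<close>

fun lookup :: "nat \<Rightarrow> (nat \<times> nat) list \<Rightarrow> nat" where
  "lookup v [] = 0"
| "lookup v ((a, b) # L) = (if a = v then b else lookup v L)"

definition relabel :: "nat \<Rightarrow> nat \<Rightarrow> (nat \<times> nat) list \<Rightarrow> (nat \<times> nat) list" where
  "relabel a b L = map (\<lambda>(v, l). (v, if l = a then b else l)) L"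

type_synonym kstate = "(nat \<times> nat) list \<times> edge_list"

text \<open>The state is a table of component labels together with the edges chosen so far. Starting
  from an arbitrary state allows runs on several induced subgraphs to be chained.\<close>

fun kruskal :: "edge_list \<Rightarrow> kstate \<Rightarrow> kstate" where
  "kruskal [] st = st"
| "kruskal ((u, v) # es) (L, F) =
     (if lookup u L = lookup v L then kruskal es (L, F)
      else kruskal es (relabel (lookup u L) (lookup v L) L, (u, v) # F))"

definition singletons :: "nat list \<Rightarrow> (nat \<times> nat) list" where
  "singletons vs = map (\<lambda>v. (v, v)) vs"

definition all_label :: "nat \<Rightarrow> nat list \<Rightarrow> (nat \<times> nat) list \<Rightarrow> bool" where
  "all_label a ts L \<longleftrightarrow> (\<forall>t\<in>set ts. lookup t L = a)"

text \<open>A trial is kept only if it joins \<open>t0\<close> and \<open>t\<close>; otherwise the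
  unextended state goes to the next \<open>s\<close>. Running \<open>kruskal\<close> on the three
  vertices, instead of adding both edges blindly, keeps the chosen edges acyclic.\<close>

fun connect :: "nat \<Rightarrow> nat \<Rightarrow> nat list \<Rightarrow> edge_list \<Rightarrow> kstate \<Rightarrow> kstate" where
  "connect t0 t [] es st = st"
| "connect t0 t (s # ss) es st =
     (let st' = kruskal (inside [t0, s, t] es) st
      in if lookup t0 (fst st') = lookup t (fst st') then st' else connect t0 t ss es st)"

fun attach :: "nat \<Rightarrow> nat list \<Rightarrow> nat list \<Rightarrow> edge_list \<Rightarrow> kstate \<Rightarrow> kstate" where
  "attach t0 [] ss es st = st"
| "attach t0 (t # ts) ss es st =
     attach t0 ts ss es
       (if lookup t0 (fst st) = lookup t (fst st) then st else connect t0 t ss es st)"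

lemma lookup_relabel:
  "v \<in> fst ` set L \<Longrightarrow>
     lookup v (relabel a b L) = (if lookup v L = a then b else lookup v L)"
  by (induction v L rule: lookup.induct) (force simp: relabel_def)+

lemma fst_set_relabel [simp]: "fst ` set (relabel a b L) = fst ` set L"
  by (simp add: relabel_def image_image case_prod_beta)

lemma lookup_singletons: "v \<in> set vs \<Longrightarrow> lookup v (singletons vs) = v"
  by (induction vs) (auto simp: singletons_def)

lemma uedges_Nil [simp]: "uedges [] = {}"
  and uedges_Cons [simp]: "uedges ((u, v) # es) = insert {u, v} (uedges es)"
  and uedges_append [simp]: "uedges (xs @ ys) = uedges xs \<union> uedges ys"
  by (auto simp: uedges_def)

lemma set_inside: "set (inside xs es) \<subseteq> set es"
  by (auto simp: inside_def)

lemma uedges_mono: "set xs \<subseteq> set ys \<Longrightarrow> uedges xs \<subseteq> uedges ys"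
  by (auto simp: uedges_def)

lemma uedges_inside: "uedges (inside xs es) = {e \<in> uedges es. e \<subseteq> set xs}"
  by (auto simp: uedges_def inside_def)

lemma card_uedges: "distinct (map (\<lambda>(u, v). {u, v}) F) \<Longrightarrow> card (uedges F) = length F"
  by (drule distinct_card) (simp add: uedges_def)

lemma mem_uedgesE:
  assumes "e \<in> uedges es"
  obtains u v where "(u, v) \<in> set es" "e = {u, v}"
  using assms by (auto simp: uedges_def)

section \<open>The invariant of the greedy steps\<close>

locale graph_lists =
  fixes vs :: "nat list" and es :: edge_list
  assumes edge_verts: "(u, v) \<in> set es \<Longrightarrow> u \<in> set vs \<and> v \<in> set vs \<and> u \<noteq> v"
begin

lemma graph_on_uedges: "set F \<subseteq> set es \<Longrightarrow> graph_on (set vs) (uedges F)"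
  using edge_verts by (fastforce simp: graph_on_def uedges_def card_2_iff)

text \<open>Distinctness refers to edges as unordered pairs, so that the length of the list, which
  the search compares, is the size of the forest.\<close>

definition kinv :: "kstate \<Rightarrow> bool" where
  "kinv = (\<lambda>(L, F). set F \<subseteq> set es \<and> distinct (map (\<lambda>(u, v). {u, v}) F) \<and> forest (uedges F) \<and>
     set vs \<subseteq> fst ` set L \<and>
     (\<forall>u\<in>set vs. \<forall>v\<in>set vs. lookup u L = lookup v L \<longleftrightarrow> same_component (uedges F) u v))"

lemma kinv_init: "kinv (singletons vs, [])"
  by (simp add: kinv_def lookup_singletons same_component_def)
    (simp add: singletons_def image_image)

lemma kinv_lookup:
  "kinv st \<Longrightarrow> u \<in> set vs \<Longrightarrow> v \<in> set vs \<Longrightarrow>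
     lookup u (fst st) = lookup v (fst st) \<longleftrightarrow> same_component (uedges (snd st)) u v"
  by (auto simp: kinv_def)

lemma kinv_forest: "kinv st \<Longrightarrow> forest (uedges (snd st))"
  by (auto simp: kinv_def)

lemma kinv_set: "kinv st \<Longrightarrow> set (snd st) \<subseteq> set es"
  by (auto simp: kinv_def)

lemma kinv_card: "kinv st \<Longrightarrow> card (uedges (snd st)) = length (snd st)"
  by (auto simp: kinv_def card_uedges)

text \<open>Recording the new edges as a prefix gives monotonicity of connectivity and control over
  the part of the graph from which they come.\<close>

definition extends :: "kstate \<Rightarrow> edge_list \<Rightarrow> kstate \<Rightarrow> bool" where
  "extends st es' st' \<longleftrightarrow> kinv st' \<and> (\<exists>A. snd st' = A @ snd st \<and> set A \<subseteq> set es')"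

lemma extends_refl: "kinv st \<Longrightarrow> extends st es' st"
  by (simp add: extends_def)

lemma extends_trans:
  "extends st es' st' \<Longrightarrow> extends st' es'' st'' \<Longrightarrow> set es' \<subseteq> set E \<Longrightarrow> set es'' \<subseteq> set E \<Longrightarrow>
     extends st E st''"
  by (auto simp: extends_def; blast)

lemma extends_kinv: "extends st es' st' \<Longrightarrow> kinv st'"
  by (simp add: extends_def)

lemma extends_mono: "extends st es' st' \<Longrightarrow> uedges (snd st) \<subseteq> uedges (snd st')"
  by (auto simp: extends_def)

lemma extends_same_component:
  "extends st es' st' \<Longrightarrow> same_component (uedges (snd st)) u v \<Longrightarrow>
     same_component (uedges (snd st')) u v"
  using extends_mono same_component_mono by blast

text \<open>Renaming one label to the other identifies exactly the two classes that
  \<open>same_component_insert\<close> merges.\<close>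

lemma kinv_add:
  assumes inv: "kinv (L, F)" and e: "(u, v) \<in> set es" and new: "lookup u L \<noteq> lookup v L"
  shows "kinv (relabel (lookup u L) (lookup v L) L, (u, v) # F)"
proof -
  have uv: "u \<in> set vs" "v \<in> set vs" "u \<noteq> v" using edge_verts e by auto
  have lab: "\<And>a b. a \<in> set vs \<Longrightarrow> b \<in> set vs \<Longrightarrow>
      lookup a L = lookup b L \<longleftrightarrow> same_component (uedges F) a b"
    and dom: "set vs \<subseteq> fst ` set L"
    using inv by (auto simp: kinv_def)
  have nc: "\<not> same_component (uedges F) u v" using lab uv new by blast
  then have "{u, v} \<notin> uedges F" using same_component_edge by blast
  then have "distinct (map (\<lambda>(u, v). {u, v}) ((u, v) # F))"
    using inv by (auto simp: kinv_def uedges_def)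
  moreover have "forest (uedges ((u, v) # F))"
    using forest_insert nc inv by (auto simp: kinv_def)
  moreover have "lookup a (relabel (lookup u L) (lookup v L) L)
        = lookup b (relabel (lookup u L) (lookup v L) L) \<longleftrightarrow>
      same_component (uedges ((u, v) # F)) a b" if "a \<in> set vs" "b \<in> set vs" for a b
  proof -
    have "a \<in> fst ` set L" "b \<in> fst ` set L" using dom that by auto
    then show ?thesis
      using that uv new
      by (simp add: lookup_relabel same_component_insert lab[symmetric])
  qed
  ultimately show ?thesis
    using inv e by (simp add: kinv_def)
qed

lemma kruskal_extends:
  assumes "kinv st" "set es' \<subseteq> set es"
  shows "extends st es' (kruskal es' st) \<and>
     (\<forall>(u, v)\<in>set es'. same_component (uedges (snd (kruskal es' st))) u v)"
  using assms
proof (induction es' st rule: kruskal.induct)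
  case (2 u v es' L F)
  have uv: "u \<in> set vs" "v \<in> set vs" using edge_verts 2 by auto
  show ?case
  proof (cases "lookup u L = lookup v L")
    case True
    then have "same_component (uedges F) u v" using kinv_lookup[OF "2.prems"(1) uv] by simp
    moreover have IH: "extends (L, F) es' (kruskal es' (L, F))"
      "\<forall>(u, v)\<in>set es'. same_component (uedges (snd (kruskal es' (L, F)))) u v"
      using "2.IH"(1)[OF True] "2.prems" by auto
    ultimately have "same_component (uedges (snd (kruskal es' (L, F)))) u v"
      using extends_same_component by fastforce
    moreover have "extends (L, F) ((u, v) # es') (kruskal es' (L, F))"
      using IH(1) by (auto simp: extends_def)
    ultimately show ?thesis using IH(2) True by auto
  next
    case False
    let ?st = "(relabel (lookup u L) (lookup v L) L, (u, v) # F)"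
    have inv: "kinv ?st" using kinv_add "2.prems" False by simp
    then have IH: "extends ?st es' (kruskal es' ?st)"
      "\<forall>(u, v)\<in>set es'. same_component (uedges (snd (kruskal es' ?st))) u v"
      using "2.IH"(2)[OF False] "2.prems" by auto
    have "same_component (uedges (snd ?st)) u v" by (simp add: same_component_edge)
    then have "same_component (uedges (snd (kruskal es' ?st))) u v"
      using IH(1) extends_same_component by blast
    moreover have "extends (L, F) ((u, v) # es') (kruskal es' ?st)"
      using IH(1) by (auto simp: extends_def)
    ultimately show ?thesis using IH(2) False by auto
  qed
qed (simp add: extends_refl)

text \<open>The ends of a skipped edge are connected already, so every edge of the induced subgraph
  ends up inside one component, whatever state the run began in.\<close>

lemma kruskal_inside:
  fixes xs :: "nat list"
  assumes "kinv st"
  defines "st' \<equiv> kruskal (inside xs es) st"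
  shows "extends st (inside xs es) st'"
    and "same_component {e \<in> uedges es. e \<subseteq> set xs} u v \<Longrightarrow> same_component (uedges (snd st')) u v"
proof -
  note k = kruskal_extends[OF assms(1) set_inside, of xs, folded st'_def]
  show "extends st (inside xs es) st'" using k by simp
  assume "same_component {e \<in> uedges es. e \<subseteq> set xs} u v"
  then show "same_component (uedges (snd st')) u v"
  proof (rule same_component_if_edges_connected)
    fix a b assume "{a, b} \<in> {e \<in> uedges es. e \<subseteq> set xs}"
    then have "{a, b} \<in> uedges (inside xs es)" by (simp add: uedges_inside)
    then obtain c d where "(c, d) \<in> set (inside xs es)" "{a, b} = {c, d}" by (rule mem_uedgesE)
    then show "same_component (uedges (snd st')) a b"
      using k same_component_sym by (fastforce simp: doubleton_eq_iff)
  qed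
qed

text \<open>With no earlier edges the converse holds too, so connectivity in the computed forest can
  be traded for connectivity in the induced subgraph.\<close>

lemma kruskal_inside_init:
  fixes xs :: "nat list"
  defines "F \<equiv> uedges (snd (kruskal (inside xs es) (singletons vs, [])))"
  shows "same_component F u v \<longleftrightarrow> same_component {e \<in> uedges es. e \<subseteq> set xs} u v"
proof
  have "F \<subseteq> uedges (inside xs es)"
    using kruskal_inside(1)[OF kinv_init, of xs] unfolding F_def extends_def
    by (auto simp: uedges_def)
  then show "same_component F u v \<Longrightarrow> same_component {e \<in> uedges es. e \<subseteq> set xs} u v"
    using same_component_mono uedges_inside by metis
qed (use kruskal_inside(2)[OF kinv_init] F_def in auto)

text \<open>Some trial succeeds, since a common neighbour of \<open>t0\<close> and \<open>t\<close>
  is among the candidates. The edges it adds form a forest on at most three vertices, so there are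
  at most two of them.\<close>

lemma connect_extends:
  assumes "kinv st" "t0 \<in> set vs" "t \<in> set vs"
    and "\<exists>s\<in>set ss. {t0, s} \<in> uedges es \<and> {s, t} \<in> uedges es"
  defines "st' \<equiv> connect t0 t ss es st"
  shows "extends st es st' \<and> same_component (uedges (snd st')) t0 t \<and>
    length (snd st') \<le> length (snd st) + 2"
  using assms(4) unfolding st'_def
proof (induction ss)
  case (Cons s ss)
  define k where "k = kruskal (inside [t0, s, t] es) st"
  have ext: "extends st (inside [t0, s, t] es) k"
    unfolding k_def by (rule kruskal_inside(1)[OF assms(1)])
  show ?case
  proof (cases "lookup t0 (fst k) = lookup t (fst k)")
    case True
    obtain A where A: "snd k = A @ snd st" "set A \<subseteq> set (inside [t0, s, t] es)"
      using ext by (auto simp: extends_def)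
    have AE: "set A \<subseteq> set es" using A(2) set_inside by blast
    have inv: "kinv k" using ext by (rule extends_kinv)
    have "card (uedges A) < card {t0, s, t}"
    proof (rule card_forest_less)
      have "uedges A \<subseteq> {e. e \<subseteq> set [t0, s, t]}"
        using uedges_mono[OF A(2)] by (auto simp: uedges_inside)
      then show "graph_on {t0, s, t} (uedges A)"
        using graph_on_uedges[OF AE] by (auto simp: graph_on_def)
      show "forest (uedges A)" using kinv_forest[OF inv] A(1) by (auto intro: forest_subset)
    qed auto
    also have "\<dots> \<le> 3" by (simp add: card_insert_if)
    also have "card (uedges A) = length A"
      using inv A(1) by (cases k) (simp add: kinv_def card_uedges)
    finally have "length (snd k) \<le> length (snd st) + 2" using A(1) by simp
    moreover have "extends st es k" using ext set_inside by (force simp: extends_def)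
    moreover have "same_component (uedges (snd k)) t0 t"
      using kinv_lookup[OF inv assms(2,3)] True by simp
    ultimately show ?thesis using True by (simp add: k_def[symmetric])
  next
    case False
    have "\<not> ({t0, s} \<in> uedges es \<and> {s, t} \<in> uedges es)"
    proof
      assume "{t0, s} \<in> uedges es \<and> {s, t} \<in> uedges es"
      then have "same_component {e \<in> uedges es. e \<subseteq> set [t0, s, t]} t0 t"
        by (intro same_component_trans[of _ t0 s t] same_component_edge) auto
      then have "same_component (uedges (snd k)) t0 t"
        unfolding k_def by (rule kruskal_inside(2)[OF assms(1)])
      then show False using False kinv_lookup[OF extends_kinv[OF ext] assms(2,3)] by simp
    qed
    then show ?thesis using Cons False by (auto simp: k_def[symmetric])
  qed
qed simp

text \<open>
  Every terminal starts out in the component of some \<open>z \<in> Z\<close>, so each call of \<^const>\<open>connect\<close> brings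
  at least one more element of \<open>Z\<close> into the component of \<open>t0\<close>.
\<close>

lemma attach_extends:
  assumes "kinv st" "t0 \<in> set vs" "set ts \<subseteq> set vs" "finite Z"
    and "\<And>t. t \<in> set ts \<Longrightarrow> t \<noteq> t0 \<Longrightarrow> \<exists>s\<in>set ss. {t0, s} \<in> uedges es \<and> {s, t} \<in> uedges es"
    and "\<And>t. t \<in> set ts \<Longrightarrow> \<exists>z\<in>Z. same_component (uedges (snd st)) t z"
  shows "extends st es (attach t0 ts ss es st) \<and>
    (\<forall>t\<in>set ts. same_component (uedges (snd (attach t0 ts ss es st))) t0 t) \<and>
    length (snd (attach t0 ts ss es st)) \<le>
      length (snd st) + 2 * card {z \<in> Z. \<not> same_component (uedges (snd st)) t0 z}"
  using assms(1,3,5,6)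
proof (induction ts arbitrary: st)
  case (Cons t ts)
  define st1 where "st1 = (if lookup t0 (fst st) = lookup t (fst st) then st else connect t0 t ss es st)"
  let ?sc = "\<lambda>st. same_component (uedges (snd st))"
  let ?open = "\<lambda>st. {z \<in> Z. \<not> ?sc st t0 z}"
  have t: "t \<in> set vs" using Cons.prems by simp
  have *: "extends st es st1 \<and> ?sc st1 t0 t \<and>
      length (snd st1) + 2 * card (?open st1) \<le> length (snd st) + 2 * card (?open st)"
  proof (cases "lookup t0 (fst st) = lookup t (fst st)")
    case True
    then show ?thesis
      using Cons.prems(1) kinv_lookup[OF Cons.prems(1) assms(2) t] by (simp add: st1_def extends_refl)
  next
    case False
    then have nc: "\<not> ?sc st t0 t" using kinv_lookup[OF Cons.prems(1) assms(2) t] by simp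
    then have "t \<noteq> t0" by auto
    then have c: "extends st es st1" "?sc st1 t0 t" "length (snd st1) \<le> length (snd st) + 2"
      using connect_extends[OF Cons.prems(1) assms(2) t Cons.prems(3)[of t]] False
      by (auto simp: st1_def)
    obtain z where z: "z \<in> Z" "?sc st t z" using Cons.prems(4)[of t] by auto
    have "z \<in> ?open st" using z nc by (auto dest: same_component_sym same_component_trans)
    moreover have "z \<notin> ?open st1"
      using c extends_same_component[OF c(1) z(2)] by (auto intro: same_component_trans)
    moreover have "?open st1 \<subseteq> ?open st" using extends_same_component[OF c(1)] by auto
    ultimately have "card (?open st1) < card (?open st)"
      using assms(4) by (intro psubset_card_mono) auto
    then show ?thesis using c by linarith
  qed
  then have inv1: "kinv st1" using extends_kinv by blast
  have IH: "extends st1 es (attach t0 ts ss es st1) \<and>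
    (\<forall>t\<in>set ts. ?sc (attach t0 ts ss es st1) t0 t) \<and>
    length (snd (attach t0 ts ss es st1)) \<le> length (snd st1) + 2 * card (?open st1)"
  proof (rule Cons.IH[OF inv1])
    show "\<exists>z\<in>Z. ?sc st1 t' z" if "t' \<in> set ts" for t'
      using that Cons.prems(4)[of t'] extends_same_component * by fastforce
  qed (use Cons.prems in auto)
  have "attach t0 (t # ts) ss es st = attach t0 ts ss es st1" by (simp add: st1_def)
  moreover have "extends st es (attach t0 ts ss es st1)" using IH * extends_trans by blast
  moreover have "?sc (attach t0 ts ss es st1) t0 t" using IH * extends_same_component by blast
  ultimately show ?case using IH * by simp
qed (simp add: extends_refl)

end

section \<open>The algorithm\<close>

definition connected_list :: "nat list \<Rightarrow> edge_list \<Rightarrow> nat list \<Rightarrow> bool" where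
  "connected_list vs es T \<longleftrightarrow>
     (let L = fst (kruskal (inside T es) (singletons vs, [])) in all_label (lookup (hd T) L) T L)"

text \<open>Each finished pair moves to the second list, so a leftover odd set finds a group to join
  unless there was a single disconnected set and no connected one.\<close>

fun groups :: "nat list list \<Rightarrow> nat list list \<Rightarrow> nat list list" where
  "groups [] C = C"
| "groups [a] [] = [a]"
| "groups [a] (g # C) = (a @ g) # C"
| "groups (a # b # D) C = groups D ((a @ b) # C)"

fun add_groups :: "nat list list \<Rightarrow> edge_list \<Rightarrow> kstate \<Rightarrow> kstate" where
  "add_groups [] es st = st"
| "add_groups (g # gs) es st = add_groups gs es (kruskal (inside g es) st)"

text \<open>\<open>X\<close> holds guessed Steiner nodes; \<open>ss\<close> supplies the connectors
  for whatever the guess leaves disconnected.\<close>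

definition complete :: "nat list \<Rightarrow> nat list \<Rightarrow> nat list \<Rightarrow> nat list \<Rightarrow> edge_list \<Rightarrow> edge_list" where
  "complete X T ss vs es =
     snd (attach (hd T) T ss es (kruskal (inside (T @ X) es) (singletons vs, [])))"

definition shorter :: "edge_list \<Rightarrow> edge_list \<Rightarrow> edge_list" where
  "shorter xs ys = (if length xs < length ys then xs else ys)"

text \<open>Each candidate of \<open>rs\<close> is skipped or taken, and \<open>q\<close> counts
  those that may still be taken; thus all subsets with at most \<open>q\<close> elements are
  tried.\<close>

fun search :: "nat list \<Rightarrow> nat \<Rightarrow> nat list \<Rightarrow> nat list \<Rightarrow> nat list \<Rightarrow> nat list \<Rightarrow> edge_list \<Rightarrow> edge_list" where
  "search [] q X T ss vs es = complete X T ss vs es"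
| "search (s # rs) q X T ss vs es =
     (if q = 0 then complete X T ss vs es
      else shorter (search rs q X T ss vs es) (search rs (q - 1) (s # X) T ss vs es))"

definition disconnected_sets :: "nat list \<Rightarrow> edge_list \<Rightarrow> nat list list \<Rightarrow> nat list list" where
  "disconnected_sets vs es ts = filter (\<lambda>T. T \<noteq> [] \<and> \<not> connected_list vs es T) ts"

definition connected_sets :: "nat list \<Rightarrow> edge_list \<Rightarrow> nat list list \<Rightarrow> nat list list" where
  "connected_sets vs es ts = filter (\<lambda>T. T \<noteq> [] \<and> connected_list vs es T) ts"

definition diff :: "nat list \<Rightarrow> nat list \<Rightarrow> nat list" where
  "diff vs T = filter (\<lambda>v. v \<notin> set T) vs"

definition solve :: "nat \<Rightarrow> nat list \<Rightarrow> edge_list \<Rightarrow> nat list list \<Rightarrow> edge_list" where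
  "solve q vs es ts =
     (let D = disconnected_sets vs es ts; C = connected_sets vs es ts
      in if length D = 1 \<and> C = []
         then search (diff vs (hd D)) q [] (hd D) (diff vs (hd D)) vs es
         else snd (add_groups (groups D C) es (singletons vs, [])))"

section \<open>Majorities, dominating Steiner nodes, and the combinatorics of search and
  grouping\<close>

lemma majorities_meet:
  assumes "finite C" "A \<subseteq> C" "B \<subseteq> C" "card C < 2 * card A" "card C < 2 * card B"
  shows "A \<inter> B \<noteq> {}"
proof
  assume "A \<inter> B = {}"
  then have "card A + card B = card (A \<union> B)"
    using assms by (intro card_Un_disjoint[symmetric]) (auto intro: finite_subset)
  also have "\<dots> \<le> card C" using assms by (intro card_mono) auto
  finally show False using assms by linarith
qed

text \<open>Counted by terminals, at least half of all pairs from \<open>U\<close> and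
  \<open>S\<close> are adjacent, so some \<open>s\<close> attains the average.\<close>

lemma half_cover:
  fixes P :: "nat \<Rightarrow> nat \<Rightarrow> bool"
  assumes "finite U" "finite S" "S \<noteq> {}"
    and dense: "\<And>t. t \<in> U \<Longrightarrow> card S < 2 * card {s \<in> S. P t s}"
  shows "\<exists>s\<in>S. card U \<le> 2 * card {t \<in> U. P t s}"
proof (rule ccontr)
  assume "\<not> ?thesis"
  then have "(\<Sum>s\<in>S. 2 * card {t \<in> U. P t s}) < (\<Sum>s\<in>S. card U)"
    using assms(2,3) by (intro sum_strict_mono) auto
  moreover have "(\<Sum>s\<in>S. card {t \<in> U. P t s}) = (\<Sum>t\<in>U. card {s \<in> S. P t s})"
    using sum.swap_restrict[OF assms(2,1), of "\<lambda>_ _. 1::nat" "\<lambda>s t. P t s"] by simp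
  moreover have "(\<Sum>t\<in>U. card S) \<le> (\<Sum>t\<in>U. 2 * card {s \<in> S. P t s})"
    by (intro sum_mono less_imp_le dense)
  ultimately show False by (simp add: sum_distrib_left[symmetric] mult.commute)
qed

text \<open>Greedy choice: \<open>half_cover\<close>, applied to the terminals not yet dominated, at
  least halves their number in each round.\<close>

lemma exponential_cover:
  fixes P :: "nat \<Rightarrow> nat \<Rightarrow> bool"
  assumes "finite T" "finite S" "S \<noteq> {}"
    and dense: "\<And>t. t \<in> T \<Longrightarrow> card S < 2 * card {s \<in> S. P t s}"
  shows "\<exists>X\<subseteq>S. card X \<le> r \<and> 2 ^ r * card {t \<in> T. \<forall>x\<in>X. \<not> P t x} \<le> card T"
proof (induction r)
  case 0
  show ?case by (rule exI[of _ "{}"]) simp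
next
  case (Suc r)
  then obtain X where X: "X \<subseteq> S" "card X \<le> r" "2 ^ r * card {t \<in> T. \<forall>x\<in>X. \<not> P t x} \<le> card T"
    by blast
  let ?U = "{t \<in> T. \<forall>x\<in>X. \<not> P t x}"
  obtain s where s: "s \<in> S" "card ?U \<le> 2 * card {t \<in> ?U. P t s}"
    using half_cover[of ?U S P] assms by auto
  have "card ?U = card {t \<in> ?U. P t s} + card {t \<in> T. \<forall>x\<in>insert s X. \<not> P t x}"
    using assms(1) by (subst card_Un_disjoint[symmetric]) (auto intro: arg_cong[of _ _ card])
  then have "2 * card {t \<in> T. \<forall>x\<in>insert s X. \<not> P t x} \<le> card ?U" using s(2) by linarith
  then have "2 ^ r * (2 * card {t \<in> T. \<forall>x\<in>insert s X. \<not> P t x}) \<le> 2 ^ r * card ?U"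
    by (rule mult_le_mono2)
  then have "2 ^ Suc r * card {t \<in> T. \<forall>x\<in>insert s X. \<not> P t x} \<le> card T"
    using X(3) by (simp only: power_Suc mult.assoc mult.left_commute)
  moreover have "card (insert s X) \<le> Suc r" using X(2) by (metis card_insert_le_m1 le_SucI
        Suc_le_mono card_insert_if finite_subset[OF X(1) assms(2)])
  ultimately show ?case using X(1) s(1) by (intro exI[of _ "insert s X"]) auto
qed

text \<open>The result is the completion of some guess, so whatever holds for all completions
  carries over to it.\<close>

lemma search_complete:
  "\<exists>X. set X \<subseteq> set Y \<union> set rs \<and> search rs q Y T ss vs es = complete X T ss vs es"
proof (induction rs arbitrary: q Y)
  case (Cons s rs)
  obtain X1 where "set X1 \<subseteq> set Y \<union> set rs" "search rs q Y T ss vs es = complete X1 T ss vs es"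
    using Cons.IH by blast
  moreover obtain X2 where "set X2 \<subseteq> set (s # Y) \<union> set rs"
    "search rs (q - 1) (s # Y) T ss vs es = complete X2 T ss vs es"
    using Cons.IH by blast
  ultimately show ?case
    by (cases "q = 0") (auto simp: shorter_def)
qed auto

text \<open>Follow the branch that takes exactly the elements of \<open>W\<close>;
  \<open>shorter\<close> never returns a list longer than either branch.\<close>

lemma search_optimal:
  assumes "W \<subseteq> set rs" "card W \<le> q"
  shows "\<exists>X. set X = set Y \<union> W \<and> length (search rs q Y T ss vs es) \<le> length (complete X T ss vs es)"
  using assms
proof (induction rs arbitrary: q Y W)
  case (Cons s rs)
  have fin: "finite W" using Cons.prems finite_subset by blast
  show ?case
  proof (cases "q = 0")
    case True
    then show ?thesis using Cons.prems fin by auto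
  next
    case False
    show ?thesis
    proof (cases "s \<in> W")
      case True
      have "W - {s} \<subseteq> set rs" "card (W - {s}) \<le> q - 1" using Cons.prems fin True by auto
      then obtain X where "set X = set (s # Y) \<union> (W - {s})"
        "length (search rs (q - 1) (s # Y) T ss vs es) \<le> length (complete X T ss vs es)"
        using Cons.IH by blast
      then show ?thesis using False True by (intro exI[of _ X]) (auto simp: shorter_def)
    next
      case f: False
      then have "W \<subseteq> set rs" using Cons.prems by auto
      then obtain X where "set X = set Y \<union> W"
        "length (search rs q Y T ss vs es) \<le> length (complete X T ss vs es)"
        using Cons.IH Cons.prems(2) by blast
      then show ?thesis using False by (intro exI[of _ X]) (auto simp: shorter_def)
    qed
  qed
qed auto

text \<open>A leftover set joins an existing group and adds none, which explains the rounding down;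
  only in the excluded case would it form a group of its own.\<close>

lemma length_groups:
  "\<not> (length D = 1 \<and> C = []) \<Longrightarrow> length (groups D C) = length C + length D div 2"
  by (induction D C rule: groups.induct) auto

text \<open>Equality of multisets transfers both distinctness and the covered vertices from the
  terminal sets to the groups.\<close>

lemma mset_concat_groups: "mset (concat (groups D C)) = mset (concat D) + mset (concat C)"
  by (induction D C rule: groups.induct) auto

context graph_lists
begin

lemma connected_list_iff:
  assumes "T \<noteq> []" "set T \<subseteq> set vs"
  shows "connected_list vs es T \<longleftrightarrow> connected_on (uedges es) (set T)"
proof -
  let ?st = "kruskal (inside T es) (singletons vs, [])"
  let ?sc = "same_component {e \<in> uedges es. e \<subseteq> set T}"
  have inv: "kinv ?st" using kruskal_inside(1)[OF kinv_init] extends_kinv by blast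
  have hd: "hd T \<in> set T" using assms(1) by simp
  have "connected_list vs es T \<longleftrightarrow> (\<forall>t\<in>set T. ?sc t (hd T))"
    using assms(2) hd kinv_lookup[OF inv]
    by (auto simp: connected_list_def all_label_def Let_def kruskal_inside_init subset_iff)
  also have "\<dots> \<longleftrightarrow> connected_on (uedges es) (set T)"
    using hd unfolding connected_on_def by (meson same_component_sym same_component_trans)
  finally show ?thesis .
qed

lemma add_groups_extends:
  assumes "kinv st"
  shows "extends st (concat (map (\<lambda>g. inside g es) gs)) (add_groups gs es st) \<and>
    (\<forall>g\<in>set gs. connected_on (uedges es) (set g) \<longrightarrow>
      (\<forall>u\<in>set g. \<forall>v\<in>set g. same_component (uedges (snd (add_groups gs es st))) u v))"
  using assms
proof (induction gs arbitrary: st)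
  case (Cons g gs)
  let ?k = "kruskal (inside g es) st"
  note k = kruskal_inside[OF Cons.prems, of g]
  have inv: "kinv ?k" using k(1) extends_kinv by blast
  note IH = Cons.IH[OF inv]
  have "extends st (concat (map (\<lambda>g. inside g es) (g # gs))) (add_groups (g # gs) es st)"
    using k(1) IH by (auto intro!: extends_trans[of st "inside g es" ?k])
  moreover have "same_component (uedges (snd (add_groups gs es ?k))) u v"
    if "connected_on (uedges es) (set g)" "u \<in> set g" "v \<in> set g" for u v
    using that k(2) IH extends_same_component unfolding connected_on_def by blast
  ultimately show ?case using IH by auto
qed (simp add: extends_refl)

end

section \<open>Lower bound\<close>

lemma finite_steiner_forests:
  assumes "sf_instance I"
  shows "finite {F. steiner_forest I F}"
proof (rule finite_subset)
  have "finite (edges I)"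
    by (rule finite_subset[of _ "Pow (verts I)"]) (use assms in \<open>auto simp: sf_instance_def\<close>)
  then show "finite (Pow (edges I))" by simp
qed (auto simp: steiner_forest_def)

lemma opt_size_le:
  "sf_instance I \<Longrightarrow> steiner_forest I F \<Longrightarrow> opt_size I \<le> card F"
  unfolding opt_size_def by (rule Min_le) (auto simp: finite_steiner_forests)

lemma opt_size_attained:
  assumes "sf_instance I" "feasible I"
  obtains F where "steiner_forest I F" "card F = opt_size I"
proof -
  have "opt_size I \<in> card ` {F. steiner_forest I F}"
    unfolding opt_size_def
    using assms by (intro Min_in) (auto simp: finite_steiner_forests feasible_def)
  then show ?thesis using that by auto
qed

section \<open>Instances given by lists\<close>

locale encoded_instance =
  fixes I :: sf_inst and vs :: "nat list" and es :: edge_list and ts :: "nat list list"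
  assumes inst: "sf_instance I"
    and vs: "lists_set vs (verts I)"
    and es: "lists_set (map (\<lambda>(u, v). {u, v}) es) (edges I)"
    and ts: "list_all2 lists_set ts (terminals I)"
begin

lemma set_vs: "set vs = verts I"
  using vs by (simp add: lists_set_def)

lemma uedges_es: "uedges es = edges I"
  using es by (auto simp: lists_set_def uedges_def)

lemma graph_on_edges: "graph_on (set vs) (edges I)"
  using inst by (auto simp: graph_on_def sf_instance_def set_vs)

sublocale graph_lists vs es
proof
  fix u v assume "(u, v) \<in> set es"
  then have "{u, v} \<in> edges I" by (force simp: uedges_def simp flip: uedges_es)
  then have "{u, v} \<subseteq> set vs" "card {u, v} = 2"
    using graph_on_edges by (auto simp: graph_on_def)
  then show "u \<in> set vs \<and> v \<in> set vs \<and> u \<noteq> v" by auto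
qed

lemma length_ts: "length ts = length (terminals I)"
  using ts by (rule list_all2_lengthD)

lemma terminals_nth: "i < length ts \<Longrightarrow> terminals I ! i = set (ts ! i) \<and> distinct (ts ! i)"
  using list_all2_nthD[OF ts] by (simp add: lists_set_def)

lemma set_terminals: "set (terminals I) = set ` set ts"
proof -
  have "terminals I = map set ts"
    by (rule nth_equalityI) (auto simp: length_ts terminals_nth)
  then show ?thesis by simp
qed

lemma ts_subset: "T \<in> set ts \<Longrightarrow> set T \<subseteq> set vs"
  using inst set_terminals by (auto simp: sf_instance_def set_vs)

lemma ts_nth_disjoint:
  "i < length ts \<Longrightarrow> j < length ts \<Longrightarrow> i \<noteq> j \<Longrightarrow> set (ts ! i) \<inter> set (ts ! j) = {}"
  using inst terminals_nth by (auto simp: sf_instance_def length_ts)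

lemma ts_disjoint:
  "T \<in> set ts \<Longrightarrow> T' \<in> set ts \<Longrightarrow> T \<noteq> T' \<Longrightarrow> set T \<inter> set T' = {}"
  using ts_nth_disjoint by (metis in_set_conv_nth)

text \<open>Disjointness is required for different positions, so only empty lists can repeat in
  \<open>ts\<close>, and these do not affect the concatenation.\<close>

lemma distinct_concat_ts: "distinct (concat ts)"
proof -
  have "distinct (concat xs)" if "\<And>i. i < length xs \<Longrightarrow> distinct (xs ! i)"
    "\<And>i j. i < length xs \<Longrightarrow> j < length xs \<Longrightarrow> i \<noteq> j \<Longrightarrow> set (xs ! i) \<inter> set (xs ! j) = {}"
    for xs :: "nat list list"
    using that
  proof (induction xs)
    case (Cons x xs)
    have "distinct (concat xs)"
      using Cons.prems(1)[of "Suc _"] Cons.prems(2)[of "Suc _" "Suc _"] by (intro Cons.IH) auto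
    moreover have "set x \<inter> set y = {}" if "y \<in> set xs" for y
      using that Cons.prems(2)[of 0 "Suc _"] by (auto simp: in_set_conv_nth)
    moreover have "distinct x" using Cons.prems(1)[of 0] by simp
    ultimately show ?case by auto
  qed simp
  then show ?thesis using terminals_nth ts_nth_disjoint by blast
qed

lemma steiner_nodes_eq: "steiner_nodes I = set vs - \<Union>(set ` set ts)"
  by (simp add: steiner_nodes_def set_terminals set_vs)

lemma steiner_forest_iff:
  "steiner_forest I F \<longleftrightarrow> F \<subseteq> edges I \<and> forest F \<and>
     (\<forall>T\<in>set ts. \<forall>u\<in>set T. \<forall>v\<in>set T. same_component F u v)"
  by (simp add: steiner_forest_def set_terminals)

abbreviation "D \<equiv> disconnected_sets vs es ts"
abbreviation "C \<equiv> connected_sets vs es ts"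

lemma mem_D: "T \<in> set D \<longleftrightarrow> T \<in> set ts \<and> T \<noteq> [] \<and> \<not> connected_on (edges I) (set T)"
  using connected_list_iff ts_subset uedges_es by (auto simp: disconnected_sets_def)

lemma mem_C: "T \<in> set C \<longleftrightarrow> T \<in> set ts \<and> T \<noteq> [] \<and> connected_on (edges I) (set T)"
  using connected_list_iff ts_subset uedges_es by (auto simp: connected_sets_def)

text \<open>A walk never leaves the component of its start.\<close>

lemma component_subset_edges:
  assumes "F \<subseteq> edges I" "same_component F u v" "u \<in> set vs"
  shows "same_component {e \<in> F. e \<subseteq> component (set vs) F u} u v"
  using assms(2)
proof (induction rule: same_component_induct)
  case (step b c)
  have "{b, c} \<subseteq> set vs" using step assms(1) graph_on_edges unfolding graph_on_def by blast
  moreover have "same_component F u c" using step same_component_edge same_component_trans by blast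
  ultimately have "same_component {e \<in> F. e \<subseteq> component (set vs) F u} b c"
    using step by (intro same_component_edge) (auto simp: component_def)
  then show ?case using step.IH same_component_trans by blast
qed simp

text \<open>
  Weigh Steiner nodes and one representative of each connected terminal set by 2, and one
  representative of each disconnected terminal set by 1. Every component of a solution has weight
  at least 2, because a component without Steiner nodes that contains no connected terminal set
  cannot consist of a single terminal set.
\<close>

lemma steiner_forest_lower_bound:
  assumes "steiner_forest I F"
  shows "2 * card (set vs) \<le> 2 * card F + 2 * card (steiner_nodes I) + 2 * length C + length D"
proof -
  let ?V = "set vs" and ?S = "steiner_nodes I"
  define w :: "nat \<Rightarrow> nat" where "w v = (if v \<in> ?S then 2 else 0) +
    (\<Sum>T\<in>set C. if v = hd T then 2 else 0) + (\<Sum>T\<in>set D. if v = hd T then 1 else 0)" for v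
  have F: "F \<subseteq> edges I" "forest F" using assms by (auto simp: steiner_forest_iff)
  have hdV: "hd T \<in> ?V" if "T \<in> set C \<or> T \<in> set D" for T
    using that ts_subset mem_C mem_D by (metis list.set_sel(1) subsetD)
  have "sum w ?V = (\<Sum>v\<in>?V. if v \<in> ?S then 2 else 0) +
      (\<Sum>T\<in>set C. \<Sum>v\<in>?V. if v = hd T then 2 else 0) +
      (\<Sum>T\<in>set D. \<Sum>v\<in>?V. if v = hd T then 1 else 0)"
    unfolding w_def sum.distrib by (subst (2 4) sum.swap) (rule refl)
  also have "\<dots> = 2 * card ?S + 2 * card (set C) + card (set D)"
  proof -
    have "(\<Sum>v\<in>?V. if v \<in> ?S then 2 else 0) = 2 * card ?S"
      by (subst sum.inter_restrict[symmetric]) (auto simp: steiner_nodes_eq Int_absorb1)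
    moreover have "(\<Sum>T\<in>set C. \<Sum>v\<in>?V. if v = hd T then 2 else 0) = 2 * card (set C)"
      using hdV by (simp add: sum.delta)
    moreover have "(\<Sum>T\<in>set D. \<Sum>v\<in>?V. if v = hd T then 1 else 0) = card (set D)"
      using hdV by (simp add: sum.delta)
    ultimately show ?thesis by simp
  qed
  \<comment> \<open>Only an upper bound on the total weight is needed, so lengths may replace
    cardinalities.\<close>
  also have "\<dots> \<le> 2 * card ?S + 2 * length C + length D"
    using card_length[of C] card_length[of D] by linarith
  finally have total: "sum w ?V \<le> 2 * card ?S + 2 * length C + length D" .
  have wC: "2 \<le> w (hd T)" if "T \<in> set C" for T
  proof -
    have "(if hd T = hd T then 2 else 0) \<le> (\<Sum>T'\<in>set C. if hd T = hd T' then 2 else (0::nat))"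
      using that by (intro member_le_sum[where f = "\<lambda>T'. if hd T = hd T' then 2 else (0::nat)"]) auto
    then show ?thesis by (simp add: w_def)
  qed
  have wD: "1 \<le> w (hd T)" if "T \<in> set D" for T
  proof -
    have "(if hd T = hd T then 1 else 0) \<le> (\<Sum>T'\<in>set D. if hd T = hd T' then 1 else (0::nat))"
      using that by (intro member_le_sum[where f = "\<lambda>T'. if hd T = hd T' then 1 else (0::nat)"]) auto
    then show ?thesis by (simp add: w_def)
  qed
  have "2 \<le> sum w (component ?V F v)" if v: "v \<in> ?V" for v
  proof -
    let ?K = "component ?V F v"
    have fin: "finite ?K" by (simp add: component_def)
    have one: "w x \<le> sum w ?K" if "x \<in> ?K" for x using that fin by (simp add: member_le_sum)
    have whole: "set T \<subseteq> ?K" if "T \<in> set ts" "x \<in> set T" "x \<in> ?K" for T x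
      using that assms ts_subset unfolding component_def steiner_forest_iff
      by (blast intro: same_component_trans)
    have terminal: "\<exists>T\<in>set ts. x \<in> set T" if "x \<in> ?K" "x \<notin> ?S" for x
      using that by (auto simp: component_def steiner_nodes_eq)
    consider s where "s \<in> ?K" "s \<in> ?S" | T where "T \<in> set C" "set T \<subseteq> ?K"
      | "?K \<inter> ?S = {}" "\<And>T. T \<in> set C \<Longrightarrow> \<not> set T \<subseteq> ?K" by blast
    then show ?thesis
    proof cases
      case 1
      then show ?thesis using one[of s] by (simp add: w_def)
    next
      case 2
      then have "hd T \<in> ?K" using mem_C by (metis list.set_sel(1) subsetD)
      then show ?thesis using one wC[OF 2(1)] le_trans by blast
    next
      case 3
      have D: "T \<in> set D" if "T \<in> set ts" "x \<in> set T" "x \<in> ?K" for T x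
        using that 3(2)[of T] whole[OF that] mem_C mem_D by fastforce
      have vK: "v \<in> ?K" using v by (simp add: component_def)
      then obtain T where T: "T \<in> set ts" "v \<in> set T" using terminal[OF vK] 3 by blast
      have TK: "set T \<subseteq> ?K" and TD: "T \<in> set D" using whole D T vK by auto
      \<comment> \<open>Otherwise the edges of \<open>F\<close> inside the component would connect
        \<open>T\<close> by itself, although it is a disconnected set.\<close>
      have "?K \<noteq> set T"
      proof
        assume K: "?K = set T"
        have "same_component {e \<in> edges I. e \<subseteq> set T} a b" if "a \<in> set T" "b \<in> set T" for a b
        proof -
          have sub: "{e \<in> F. e \<subseteq> ?K} \<subseteq> {e \<in> edges I. e \<subseteq> set T}" using F(1) K by auto
          have "same_component {e \<in> edges I. e \<subseteq> set T} v x" if "x \<in> set T" for x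
          proof (rule same_component_mono[OF _ sub])
            show "same_component {e \<in> F. e \<subseteq> ?K} v x"
              using component_subset_edges[OF F(1) _ v] that K by (auto simp: component_def)
          qed
          from this[OF that(1)] this[OF that(2)] show ?thesis by (rule same_component_euclid)
        qed
        then show False using TD by (simp add: mem_D connected_on_def)
      qed
      then obtain v' where v': "v' \<in> ?K" "v' \<notin> set T" using TK by blast
      then obtain T' where T': "T' \<in> set ts" "v' \<in> set T'" using terminal 3 by blast
      have TK': "set T' \<subseteq> ?K" and TD': "T' \<in> set D" using whole D T' v' by auto
      have hds: "hd T \<in> set T" "hd T' \<in> set T'" using TD TD' mem_D by auto
      have "T \<noteq> T'" using T' v' by auto
      then have "hd T \<noteq> hd T'" using ts_disjoint[OF T(1) T'(1)] hds by auto
      then have "w (hd T) + w (hd T') = sum w {hd T, hd T'}" by simp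
      also have "\<dots> \<le> sum w ?K" using hds TK TK' fin by (intro sum_mono2) auto
      finally show ?thesis using wD[OF TD] wD[OF TD'] by linarith
    qed
  qed
  then have "2 * card (components ?V F) \<le> sum w ?V"
    by (intro card_components_le_weight) auto
  moreover have "card F + card (components ?V F) = card ?V"
    using F graph_on_edges by (intro card_forest) (auto simp: graph_on_def)
  ultimately show ?thesis using total by linarith
qed

end

section \<open>Correctness\<close>

locale dense_instance = encoded_instance +
  fixes \<delta> :: real
  assumes dense: "pairwise_dense \<delta> I" and \<delta>: "\<delta> > 1 / 2"
begin

text \<open>The bound 1/2 on \<delta> enters here; positivity of \<open>card B\<close> makes the
  majority strict.\<close>

lemma majority_of_dense: "\<delta> * real (card B) \<le> real (card A) \<Longrightarrow> card B > 0 \<Longrightarrow> card B < 2 * card A"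
proof -
  assume a: "\<delta> * real (card B) \<le> real (card A)" and "card B > 0"
  then have "real (card B) < 2 * (\<delta> * real (card B))" using \<delta> by (simp add: field_simps)
  then have "real (card B) < 2 * real (card A)" using a by linarith
  then show ?thesis by linarith
qed

lemma terminal_neighbours:
  assumes "T \<in> set ts" "T' \<in> set ts" "T \<noteq> T'" "T' \<noteq> []" "t \<in> set T"
  shows "card (set T') < 2 * card {v \<in> set T'. {t, v} \<in> edges I}"
proof -
  obtain i j where "i < length ts" "T = ts ! i" "j < length ts" "T' = ts ! j"
    using assms by (auto simp: in_set_conv_nth)
  then have "\<delta> * real (card (set T')) \<le> real (card {v \<in> set T'. {t, v} \<in> edges I})"
    using dense assms terminals_nth by (auto simp: pairwise_dense_def length_ts)
  then show ?thesis using assms by (intro majority_of_dense) (auto simp: card_gt_0_iff)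
qed

lemma steiner_neighbours:
  assumes "T \<in> set ts" "t \<in> set T" "steiner_nodes I \<noteq> {}"
  shows "card (steiner_nodes I) < 2 * card {v \<in> steiner_nodes I. {t, v} \<in> edges I}"
proof -
  obtain i where "i < length ts" "T = ts ! i" using assms by (auto simp: in_set_conv_nth)
  then have "\<delta> * real (card (steiner_nodes I)) \<le> real (card {v \<in> steiner_nodes I. {t, v} \<in> edges I})"
    using dense assms terminals_nth by (auto simp: pairwise_dense_def length_ts)
  then show ?thesis
    using assms(3) by (intro majority_of_dense) (auto simp: card_gt_0_iff steiner_nodes_eq)
qed

lemma common_steiner_neighbour:
  assumes "T \<in> set ts" "u \<in> set T" "v \<in> set T" "steiner_nodes I \<noteq> {}"
  shows "\<exists>s\<in>steiner_nodes I. {u, s} \<in> edges I \<and> {s, v} \<in> edges I"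
  using majorities_meet[OF _ _ _ steiner_neighbours[OF assms(1,2,4)] steiner_neighbours[OF assms(1,3,4)]]
  by (auto simp: steiner_nodes_eq insert_commute)

text \<open>This is the shape that \<open>groups\<close> preserves when it concatenates; it lets
  \<open>connected_on_union\<close> find whole terminal sets inside a group.\<close>

definition union_of_terminals :: "nat set \<Rightarrow> bool" where
  "union_of_terminals W \<longleftrightarrow> (\<exists>J\<subseteq>set ts. W = \<Union>(set ` J))"

lemma union_of_terminals_Un:
  "union_of_terminals W \<Longrightarrow> union_of_terminals W' \<Longrightarrow> union_of_terminals (W \<union> W')"
  unfolding union_of_terminals_def by (metis Un_subset_iff image_Un Union_Un_distrib)

lemma union_of_terminals_single: "T \<in> set ts \<Longrightarrow> union_of_terminals (set T)"
  unfolding union_of_terminals_def by (rule exI[of _ "{T}"]) auto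

text \<open>Two terminals of one set share a neighbour in a set on the other side; for terminals of
  different sets, one step leads from the second into the set of the first.\<close>

lemma connected_on_union:
  assumes "union_of_terminals W1" "union_of_terminals W2" "W1 \<inter> W2 = {}" "W1 \<noteq> {}" "W2 \<noteq> {}"
  shows "connected_on (edges I) (W1 \<union> W2)"
proof -
  let ?W = "W1 \<union> W2"
  let ?sc = "same_component {e \<in> edges I. e \<subseteq> ?W}"
  have terminal: "\<exists>T\<in>set ts. x \<in> set T \<and> set T \<subseteq> W" if "union_of_terminals W" "x \<in> W" for x W
    using that unfolding union_of_terminals_def by blast
  have edge: "?sc a b" if "{a, b} \<in> edges I" "a \<in> ?W" "b \<in> ?W" for a b
    using that by (intro same_component_edge) auto
  have via: "?sc u v" if "T \<in> set ts" "T' \<in> set ts" "T \<noteq> T'" "T' \<noteq> []" "u \<in> set T" "v \<in> set T"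
    "set T \<subseteq> ?W" "set T' \<subseteq> ?W" for T T' u v
  proof -
    have "{x \<in> set T'. {u, x} \<in> edges I} \<inter> {x \<in> set T'. {v, x} \<in> edges I} \<noteq> {}"
      by (rule majorities_meet[OF _ _ _ terminal_neighbours[OF that(1-5)]
            terminal_neighbours[OF that(1-4,6)]]) auto
    then obtain x where "x \<in> set T'" "{u, x} \<in> edges I" "{v, x} \<in> edges I" by blast
    then have "?sc u x" "?sc v x" using edge that by (meson subsetD)+
    then show ?thesis by (rule same_component_trans[OF _ same_component_sym])
  qed
  have same: "?sc u v" if h: "T \<in> set ts" "u \<in> set T" "v \<in> set T" "set T \<subseteq> ?W" "set T \<subseteq> W1 \<or> set T \<subseteq> W2" for T u v
  proof -
    \<comment> \<open>A vertex from the other side guarantees a terminal set different from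
      \<open>T\<close>.\<close>
    obtain x where "x \<in> ?W" "x \<notin> set T" "set T \<subseteq> W1 \<and> x \<in> W2 \<or> set T \<subseteq> W2 \<and> x \<in> W1"
      using assms(3-5) h(5) by blast
    moreover from this obtain T' where "T' \<in> set ts" "x \<in> set T'" "set T' \<subseteq> ?W"
      using terminal[OF assms(1), of x] terminal[OF assms(2), of x] by blast
    ultimately show ?thesis using h by (intro via[of T T']) auto
  qed
  have "?sc u v" if u: "u \<in> ?W" and v: "v \<in> ?W" for u v
  proof -
    obtain T where T: "T \<in> set ts" "u \<in> set T" "set T \<subseteq> W1 \<or> set T \<subseteq> W2"
      using u terminal[OF assms(1), of u] terminal[OF assms(2), of u] by blast
    obtain T' where T': "T' \<in> set ts" "v \<in> set T'" "set T' \<subseteq> W1 \<or> set T' \<subseteq> W2"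
      using v terminal[OF assms(1), of v] terminal[OF assms(2), of v] by blast
    show ?thesis
    proof (cases "T = T'")
      case True
      then show ?thesis using same T T' by blast
    next
      case False
      have "T \<noteq> []" using T by auto
      \<comment> \<open>Move from \<open>v\<close> into \<open>T\<close>: a strict majority of
        \<open>T\<close> cannot be empty.\<close>
      from terminal_neighbours[OF T'(1) T(1) False[symmetric] this T'(2)]
      have "{x \<in> set T. {v, x} \<in> edges I} \<noteq> {}" by (metis card.empty mult_0_right not_less_zero)
      then obtain x where x: "x \<in> set T" "{v, x} \<in> edges I" by blast
      then have "?sc v x" using edge v T by blast
      moreover have "?sc u x" using same T x by blast
      ultimately show ?thesis by (blast intro: same_component_trans[OF _ same_component_sym])
    qed
  qed
  then show ?thesis by (simp add: connected_on_def)
qed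

text \<open>New or enlarged groups are connected by \<open>connected_on_union\<close>, the others by
  assumption. After a pairing the second list is nonempty, so the exceptional case cannot arise in
  the recursion.\<close>

lemma groups_connected:
  assumes "\<not> (length D' = 1 \<and> C' = [])" "distinct (concat (D' @ C'))"
    and "\<And>g. g \<in> set (D' @ C') \<Longrightarrow> g \<noteq> [] \<and> union_of_terminals (set g)"
    and "\<And>g. g \<in> set C' \<Longrightarrow> connected_on (edges I) (set g)"
  shows "\<forall>g\<in>set (groups D' C'). g \<noteq> [] \<and> union_of_terminals (set g) \<and> connected_on (edges I) (set g)"
  using assms
proof (induction D' C' rule: groups.induct)
  case (3 a g C')
  then show ?case
    using connected_on_union[of "set a" "set g"] union_of_terminals_Un by (auto simp: Int_Un_distrib)
next
  case (4 a b D' C')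
  have "connected_on (edges I) (set (a @ b))" "union_of_terminals (set (a @ b))" "a @ b \<noteq> []"
    using 4(3,4) connected_on_union[of "set a" "set b"] union_of_terminals_Un
    by (auto simp: Int_Un_distrib)
  then show ?case
    unfolding groups.simps
  proof (intro "4.IH")
    show "distinct (concat (D' @ (a @ b) # C'))"
      using 4(3) by (auto simp: Int_Un_distrib Int_Un_distrib2 Int_commute)
    show "g \<noteq> [] \<and> union_of_terminals (set g)" if "g \<in> set (D' @ (a @ b) # C')" for g
      using that 4(4)[of g] \<open>union_of_terminals (set (a @ b))\<close> \<open>a @ b \<noteq> []\<close> by auto
    show "connected_on (edges I) (set g)" if "g \<in> set ((a @ b) # C')" for g
      using that 4(5)[of g] \<open>connected_on (edges I) (set (a @ b))\<close> by auto
  qed simp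
qed auto

text \<open>All chosen edges run inside groups, so no component contains two groups, or a Steiner
  node and anything else. This lower bound on the components of the result matches the weight bound
  for arbitrary solutions up to rounding.\<close>

lemma solve_groups_optimal:
  assumes case_split: "\<not> (length D = 1 \<and> C = [])"
  defines "st \<equiv> add_groups (groups D C) es (singletons vs, [])"
  shows "kinv st \<and> steiner_forest I (uedges (snd st)) \<and> card (uedges (snd st)) = opt_size I"
proof -
  let ?gs = "groups D C" and ?F = "uedges (snd st)" and ?S = "steiner_nodes I" and ?V = "set vs"
  have mem_DC: "T \<in> set D \<or> T \<in> set C \<longleftrightarrow> T \<in> set ts \<and> T \<noteq> []" for T
    using mem_C mem_D by auto
  have "mset (concat D) + mset (concat C) = mset (concat ts)"
    unfolding disconnected_sets_def connected_sets_def by (induction ts) auto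
  then have mset: "mset (concat (D @ C)) = mset (concat ts)" "mset (concat ?gs) = mset (concat ts)"
    by (simp_all add: mset_concat_groups)
  then have dist: "distinct (concat (D @ C))" "distinct (concat ?gs)"
    using distinct_concat_ts mset_eq_imp_distinct_iff by blast+
  have set: "set (concat ?gs) = \<Union>(set ` set ts)" using mset_eq_setD[OF mset(2)] by simp
  have gs: "\<forall>g\<in>set ?gs. g \<noteq> [] \<and> union_of_terminals (set g) \<and> connected_on (edges I) (set g)"
    using case_split dist(1)
  proof (rule groups_connected)
    show "g \<noteq> [] \<and> union_of_terminals (set g)" if "g \<in> set (D @ C)" for g
      using that mem_DC union_of_terminals_single by auto
  qed (simp add: mem_C)
  note add = add_groups_extends[OF kinv_init, of ?gs, folded st_def]
  have inv: "kinv st" using add extends_kinv by blast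
  have sub: "?F \<subseteq> edges I" using kinv_set[OF inv] uedges_mono uedges_es by blast
  have feas: "steiner_forest I ?F"
    unfolding steiner_forest_iff
  proof (intro conjI ballI)
    fix T u v assume T: "T \<in> set ts" "u \<in> set T" "v \<in> set T"
    then obtain g where g: "g \<in> set ?gs" "u \<in> set g" using set by auto
    have "union_of_terminals (set g)" using gs g(1) by simp
    then obtain J where J: "J \<subseteq> set ts" "set g = \<Union>(set ` J)"
      unfolding union_of_terminals_def by blast
    then obtain T' where "T' \<in> J" "u \<in> set T'" using g(2) by auto
    then have "T' = T" using ts_disjoint[of T' T] T J(1) by blast
    then have "v \<in> set g" using T(3) J(2) \<open>T' \<in> J\<close> by blast
    then show "same_component ?F u v" using add gs g uedges_es by auto
  qed (use kinv_forest[OF inv] sub in auto)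
  have groupwise: "\<exists>g\<in>set ?gs. e \<subseteq> set g" if "e \<in> ?F" for e
  proof -
    have "set (snd st) \<subseteq> set (concat (map (\<lambda>g. inside g es) ?gs))" using add by (auto simp: extends_def)
    then show ?thesis using that by (fastforce simp: uedges_def inside_def)
  qed
  have unique: "g = h" if "g \<in> set ?gs" "h \<in> set ?gs" "x \<in> set g" "x \<in> set h" for g h x
    using dist(2) that unfolding distinct_concat_iff by blast
  \<comment> \<open>One representative for each expected component.\<close>
  define R where "R = ?S \<union> hd ` set ?gs"
  have hds: "hd g \<in> set g" if "g \<in> set ?gs" for g using that gs by simp
  have "card R = card ?S + length ?gs"
  proof -
    have "inj_on hd (set ?gs)" using unique hds by (metis inj_onI)
    \<comment> \<open>Disjoint groups are distinct because none of them is empty.\<close>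
    moreover have "distinct ?gs" using dist(2) gs by (auto simp: distinct_concat_iff removeAll_id)
    ultimately have "card (hd ` set ?gs) = length ?gs" by (simp add: card_image distinct_card)
    moreover have "?S \<inter> hd ` set ?gs = {}" using hds set by (auto simp: steiner_nodes_eq)
    ultimately show ?thesis by (simp add: R_def card_Un_disjoint steiner_nodes_eq)
  qed
  moreover have "card R \<le> card (components ?V ?F)"
  proof (rule card_components_ge)
    show "R \<subseteq> ?V" using hds set ts_subset by (auto simp: R_def steiner_nodes_eq)
    fix u v assume u: "u \<in> R" and v: "v \<in> R" and uv: "same_component ?F u v"
    show "u = v"
    proof (cases "u \<in> ?S")
      case True
      then have "u \<notin> set g" if "g \<in> set ?gs" for g using that set by (auto simp: steiner_nodes_eq)
      \<comment> \<open>A Steiner node lies in no group, hence on no chosen edge.\<close>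
      then have "v \<in> {u}" using groupwise by (intro same_component_closed[OF uv]) blast+
      then show ?thesis by simp
    next
      case False
      then obtain g where g: "g \<in> set ?gs" "u = hd g" using u by (auto simp: R_def)
      have vg: "v \<in> set g"
        using uv
      proof (rule same_component_closed)
        show "b \<in> set g" if "{a, b} \<in> ?F" "a \<in> set g" for a b
          using groupwise[OF that(1)] unique[OF g(1)] that(2) by blast
      qed (use g hds in auto)
      then have "v \<notin> ?S" using g(1) set by (auto simp: steiner_nodes_eq)
      then obtain h where "h \<in> set ?gs" "v = hd h" using v by (auto simp: R_def)
      then show ?thesis using unique[OF g(1)] vg hds g by blast
    qed
  qed simp
  moreover have "card ?F + card (components ?V ?F) = card ?V"
    using sub graph_on_edges kinv_forest[OF inv] by (intro card_forest) (auto simp: graph_on_def)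
  ultimately have upper: "card ?F + card ?S + (length C + length D div 2) \<le> card ?V"
    using length_groups[OF case_split] by linarith
  have "card ?F \<le> opt_size I"
  proof -
    obtain F' where "steiner_forest I F'" "card F' = opt_size I"
      using opt_size_attained inst feas feasible_def by metis
    then have "2 * card ?V \<le> 2 * opt_size I + 2 * card ?S + 2 * length C + length D"
      using steiner_forest_lower_bound by metis
    \<comment> \<open>The doubled inequalities differ by \<open>length D mod 2\<close>, which is at
      most 1, and integrality removes this gap.\<close>
    then show ?thesis using upper by linarith
  qed
  then show ?thesis using inv feas opt_size_le[OF inst feas] by simp
qed

end

section \<open>One terminal set that is not connected by itself\<close>

locale single_terminal_set = dense_instance +
  fixes T :: "nat list"
  assumes D_single: "D = [T]" and C_empty: "C = []"
begin

lemma T_mem: "T \<in> set ts" "T \<noteq> []" "\<not> connected_on (edges I) (set T)"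
  using mem_D D_single by auto

lemma T_only: "T' \<in> set ts \<Longrightarrow> T' = T \<or> T' = []"
  using mem_C[of T'] mem_D[of T'] D_single C_empty by auto

lemma steiner_nodes_diff: "steiner_nodes I = set (diff vs T)"
proof -
  have "set T' \<subseteq> set T" if "T' \<in> set ts" for T' using T_only[OF that] by auto
  then have "\<Union>(set ` set ts) = set T" using T_mem(1) by blast
  then show ?thesis by (auto simp: steiner_nodes_eq diff_def)
qed

lemma verts_split: "set vs = set T \<union> steiner_nodes I"
  using ts_subset[OF T_mem(1)] by (auto simp: steiner_nodes_diff diff_def)

lemma steiner_forest_iff_single:
  "steiner_forest I F \<longleftrightarrow> F \<subseteq> edges I \<and> forest F \<and> (\<forall>u\<in>set T. \<forall>v\<in>set T. same_component F u v)"
  using T_mem T_only unfolding steiner_forest_iff by fastforce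

text \<open>Without Steiner nodes every solution would run inside \<open>T\<close> and connect it
  there.\<close>

lemma feasible_imp_steiner_nodes:
  assumes "feasible I"
  shows "steiner_nodes I \<noteq> {}"
proof
  assume "steiner_nodes I = {}"
  then have V: "set vs = set T" using verts_split by simp
  obtain F where F: "steiner_forest I F" using assms by (auto simp: feasible_def)
  have "F \<subseteq> {e \<in> edges I. e \<subseteq> set T}"
    using F graph_on_edges V by (auto simp: steiner_forest_iff_single graph_on_def)
  then have "connected_on (edges I) (set T)"
    using F same_component_mono unfolding steiner_forest_iff_single connected_on_def by blast
  then show False using T_mem by simp
qed

text \<open>The spanning forest on \<open>T\<close> and the guess has fewer edges than vertices, and
  each later connection costs two. The set \<open>Z\<close> for counting connections stays free:
  terminals themselves when the guess is an optimal node set, guessed nodes and undominated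
  terminals for the approximation.\<close>

lemma complete_steiner_forest:
  fixes X :: "nat list"
  assumes ne: "steiner_nodes I \<noteq> {}" and X: "set X \<subseteq> steiner_nodes I"
  defines "F \<equiv> complete X T (diff vs T) vs es"
  defines "sc \<equiv> same_component {e \<in> edges I. e \<subseteq> set T \<union> set X}"
  shows "\<exists>L. kinv (L, F)" and "steiner_forest I (uedges F)"
    and "finite Z \<Longrightarrow> (\<And>t. t \<in> set T \<Longrightarrow> \<exists>z\<in>Z. sc t z) \<Longrightarrow>
      length F < card (set T \<union> set X) + 2 * card {z \<in> Z. \<not> sc (hd T) z}"
proof -
  define st0 where "st0 = kruskal (inside (T @ X) es) (singletons vs, [])"
  define st where "st = attach (hd T) T (diff vs T) es st0"
  have F: "F = snd st" by (simp add: F_def st_def st0_def complete_def)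
  have ext0: "extends (singletons vs, []) (inside (T @ X) es) st0"
    unfolding st0_def by (rule kruskal_inside(1)[OF kinv_init])
  then have inv0: "kinv st0" by (rule extends_kinv)
  have sc: "same_component (uedges (snd st0)) u v \<longleftrightarrow> sc u v" for u v
    unfolding st0_def kruskal_inside_init sc_def uedges_es by simp
  have TV: "set T \<subseteq> set vs" and hd: "hd T \<in> set T" "hd T \<in> set vs"
    using ts_subset[OF T_mem(1)] T_mem(2) by auto
  have nbr: "\<exists>s\<in>set (diff vs T). {hd T, s} \<in> uedges es \<and> {s, t} \<in> uedges es"
    if "t \<in> set T" for t
    using common_steiner_neighbour[OF T_mem(1) hd(1) that ne] steiner_nodes_diff uedges_es by simp
  have att: "extends st0 es st \<and> (\<forall>t\<in>set T. same_component (uedges (snd st)) (hd T) t) \<and>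
    length (snd st) \<le> length (snd st0) + 2 * card {z \<in> Z. \<not> sc (hd T) z}"
    if "finite Z" "\<And>t. t \<in> set T \<Longrightarrow> \<exists>z\<in>Z. sc t z" for Z
    using attach_extends[OF inv0 hd(2) TV that(1), of "diff vs T"] nbr that(2)
    by (simp add: sc st_def)
  \<comment> \<open>The trivial choice of \<open>Z\<close> suffices for the first two claims, which
    do not mention it.\<close>
  have "\<And>t. t \<in> set T \<Longrightarrow> \<exists>z\<in>set T. sc t z" using same_component_refl sc_def by blast
  note att' = att[OF _ this, simplified]
  have inv: "kinv st" using att' extends_kinv by blast
  then show "\<exists>L. kinv (L, F)" using F by (metis prod.collapse)
  have "\<forall>u\<in>set T. \<forall>v\<in>set T. same_component (uedges F) u v"
    using att' F same_component_euclid by metis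
  then show "steiner_forest I (uedges F)"
    using kinv_forest[OF inv] kinv_set[OF inv] uedges_mono uedges_es F
    unfolding steiner_forest_iff_single by blast
  assume Z: "finite Z" "\<And>t. t \<in> set T \<Longrightarrow> \<exists>z\<in>Z. sc t z"
  have "uedges (snd st0) \<subseteq> {e \<in> edges I. e \<subseteq> set T \<union> set X}"
    using ext0 uedges_mono[of "snd st0" "inside (T @ X) es"] uedges_inside[of "T @ X" es] uedges_es
    by (auto simp: extends_def)
  then have "graph_on (set T \<union> set X) (uedges (snd st0))"
    using graph_on_edges by (auto simp: graph_on_def)
  then have "card (uedges (snd st0)) < card (set T \<union> set X)"
    using kinv_forest[OF inv0] T_mem(2) by (intro card_forest_less) auto
  then show "length F < card (set T \<union> set X) + 2 * card {z \<in> Z. \<not> sc (hd T) z}"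
    using att[of Z] Z kinv_card[OF inv0] F by fastforce
qed

lemma card_T: "card (set T) = length T"
proof -
  have "distinct T" using T_mem(1) terminals_nth by (metis in_set_conv_nth)
  then show ?thesis by (rule distinct_card)
qed

lemma length_T_ge_2: "2 \<le> length T"
proof (rule ccontr)
  assume "\<not> ?thesis"
  then obtain t where "T = [t]" using T_mem(2) by (cases T; cases "tl T") auto
  then show False using T_mem(3) by (simp add: connected_on_def)
qed

text \<open>Restricted to the component of the terminals, an optimal solution is a tree and still a
  solution, so by optimality it has no fewer edges.\<close>

lemma optimal_tree:
  assumes "feasible I"
  obtains W where "set T \<subseteq> W" "W \<subseteq> set vs" "connected_on (edges I) W" "card W = Suc (opt_size I)"
proof -
  obtain F where F: "steiner_forest I F" "card F = opt_size I"
    using opt_size_attained[OF inst assms] by blast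
  have FE: "F \<subseteq> edges I" "forest F" and FT: "\<And>u v. u \<in> set T \<Longrightarrow> v \<in> set T \<Longrightarrow> same_component F u v"
    using F(1) by (auto simp: steiner_forest_iff_single)
  have hd: "hd T \<in> set T" "hd T \<in> set vs" using ts_subset[OF T_mem(1)] T_mem(2) by auto
  define W where "W = component (set vs) F (hd T)"
  define F' where "F' = {e \<in> F. e \<subseteq> W}"
  have TW: "set T \<subseteq> W" using FT hd ts_subset[OF T_mem(1)] by (auto simp: W_def component_def)
  have conn: "same_component F' u v" if "u \<in> W" "v \<in> W" for u v
  proof -
    have "same_component F' (hd T) x" if "x \<in> W" for x
      using component_subset_edges[OF FE(1) _ hd(2)] that by (auto simp: F'_def W_def component_def)
    from this[OF that(1)] this[OF that(2)] show ?thesis by (rule same_component_euclid)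
  qed
  have F': "F' \<subseteq> edges I" "forest F'" using FE forest_subset by (auto simp: F'_def)
  then have "steiner_forest I F'" using conn TW by (auto simp: steiner_forest_iff_single)
  then have "opt_size I \<le> card F'" using opt_size_le inst by blast
  moreover have "finite F" using FE(1) graph_on_edges graph_on_finite finite_set finite_subset by metis
  then have "card F' \<le> card F" by (intro card_mono) (auto simp: F'_def)
  moreover have "Suc (card F') = card W"
  proof (rule card_tree)
    show "graph_on W F'" using F' graph_on_edges by (auto simp: graph_on_def F'_def)
  qed (use F' conn TW hd in \<open>auto simp: W_def component_def\<close>)
  ultimately have "card W = Suc (opt_size I)" using F(2) by simp
  moreover have "connected_on (edges I) W"
    unfolding connected_on_def
  proof (intro ballI)
    show "same_component {e \<in> edges I. e \<subseteq> W} u v" if "u \<in> W" "v \<in> W" for u v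
      using conn[OF that] by (rule same_component_mono) (use F' in \<open>auto simp: F'_def\<close>)
  qed
  ultimately show ?thesis using that TW by (auto simp: W_def component_def)
qed

lemma search_approximates:
  assumes feas: "feasible I" and n: "n > 0"
  defines "F \<equiv> search (diff vs T) (200 * n * n) [] T (diff vs T) vs es"
  shows "n * length F \<le> (n + 1) * opt_size I"
proof -
  have ne: "steiner_nodes I \<noteq> {}" using feas by (rule feasible_imp_steiner_nodes)
  obtain W where W: "set T \<subseteq> W" "W \<subseteq> set vs" "connected_on (edges I) W" "card W = Suc (opt_size I)"
    using optimal_tree[OF feas] by blast
  let ?S = "set (diff vs T)"
  let ?c = "\<lambda>X. complete X T (diff vs T) vs es"
  have finW: "finite W" using W(2) finite_subset by blast
  \<comment> \<open>This is the lower bound \<open>|T| - 1\<close> on the optimum.\<close>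
  have T_le: "length T \<le> Suc (opt_size I)" using card_mono[OF finW W(1)] W(4) card_T by simp
  have opt: "\<exists>X. set X = Y \<and> length F \<le> length (?c X)" if "Y \<subseteq> ?S" "card Y \<le> 200 * n * n" for Y
    using search_optimal[OF that, of "[]" T "diff vs T" vs es] by (simp add: F_def)
  have nn: "n \<le> n * n" using n by simp
  have refl: "\<exists>z\<in>set T. same_component E t z" if "t \<in> set T" for t E
    using that same_component_refl by blast
  text \<open>
    With \<open>r = 8 * n\<close> dominating nodes the excess over \<open>|T| - 1\<close> is at most \<open>3 * r + 2 * |T| / 2 ^ r\<close>,
    which is below \<open>|T| / n\<close> once \<open>|T| > 48 * n * n\<close>. Otherwise an optimal tree has at most
    \<open>2 * |T| + 1 \<le> 200 * n * n\<close> Steiner nodes.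
  \<close>
  show ?thesis
  proof (cases "length T \<le> 48 * n * n")
    case True
    \<comment> \<open>The completion of the empty guess bounds the optimum, and thereby the number
      of Steiner nodes in \<open>W\<close>.\<close>
    have "opt_size I \<le> 3 * length T"
    proof -
      have "length (?c []) < card (set T \<union> set []) +
          2 * card {z \<in> set T. \<not> same_component {e \<in> edges I. e \<subseteq> set T \<union> set []} (hd T) z}"
        using ne by (intro complete_steiner_forest(3) refl) auto
      also have "\<dots> \<le> length T + 2 * length T"
        using card_mono[of "set T" "{z \<in> set T. \<not> same_component {e \<in> edges I. e \<subseteq> set T \<union> set []} (hd T) z}"] card_T
        by auto
      finally have "length (?c []) \<le> 3 * length T" by simp
      moreover obtain L where "kinv (L, ?c [])" using complete_steiner_forest(1)[OF ne, of "[]"] by auto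
      then have "card (uedges (?c [])) = length (?c [])" using kinv_card by fastforce
      moreover have "opt_size I \<le> card (uedges (?c []))"
        using ne by (intro opt_size_le inst complete_steiner_forest(2)) auto
      ultimately show ?thesis by linarith
    qed
    moreover have "card (W - set T) = card W - length T"
      using W(1) finW card_T by (simp add: card_Diff_subset)
    ultimately have "card (W - set T) \<le> 2 * length T + 1" using W(4) by linarith
    also have "\<dots> \<le> 96 * n * n + n" using True n by linarith
    also have "\<dots> \<le> 200 * n * n" using nn by simp
    finally obtain X where X: "set X = W - set T" "length F \<le> length (?c X)"
      using opt[of "W - set T"] W(2) by (auto simp: diff_def)
    have WX: "set T \<union> set X = W" using X W(1) by auto
    have "length (?c X) < card (set T \<union> set X) +
          2 * card {z \<in> set T. \<not> same_component {e \<in> edges I. e \<subseteq> set T \<union> set X} (hd T) z}"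
      using ne X W(2) verts_split
      by (intro complete_steiner_forest(3) refl) auto
    \<comment> \<open>With the nodes of an optimal tree as guess, nothing is left to attach, so this
      case is exact.\<close>
    also have "{z \<in> set T. \<not> same_component {e \<in> edges I. e \<subseteq> set T \<union> set X} (hd T) z} = {}"
      using W(1,3) hd_in_set[OF T_mem(2)] unfolding WX connected_on_def by blast
    finally have "length F \<le> opt_size I" using X(2) W(4) WX by simp
    then have "n * length F \<le> n * opt_size I" by (rule mult_le_mono2)
    also have "\<dots> \<le> (n + 1) * opt_size I" by simp
    finally show ?thesis .
  next
    case False
    define r where "r = 8 * n"
    obtain Y where Y: "Y \<subseteq> steiner_nodes I" "card Y \<le> r"
      "2 ^ r * card {t \<in> set T. \<forall>x\<in>Y. {t, x} \<notin> edges I} \<le> card (set T)"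
      using exponential_cover[of "set T" "steiner_nodes I" "\<lambda>t s. {t, s} \<in> edges I" r]
        steiner_neighbours[OF T_mem(1) _ ne] ne by (auto simp: steiner_nodes_diff)
    let ?U = "{t \<in> set T. \<forall>x\<in>Y. {t, x} \<notin> edges I}"
    have finY: "finite Y" using Y(1) steiner_nodes_diff finite_subset by auto
    have "r \<le> 200 * n * n" using nn by (simp add: r_def)
    then obtain X where X: "set X = Y" "length F \<le> length (?c X)"
      using opt[of Y] Y steiner_nodes_diff by auto
    let ?sc = "same_component {e \<in> edges I. e \<subseteq> set T \<union> set X}"
    have "length (?c X) < card (set T \<union> set X) + 2 * card {z \<in> Y \<union> ?U. \<not> ?sc (hd T) z}"
    proof (rule complete_steiner_forest(3)[OF ne])
      show "\<exists>z\<in>Y \<union> ?U. ?sc t z" if t: "t \<in> set T" for t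
      proof (cases "t \<in> ?U")
        case True
        then show ?thesis using same_component_refl by blast
      next
        case False
        then obtain x where "x \<in> Y" "{t, x} \<in> edges I" using t by blast
        moreover from this have "?sc t x" using t X(1) by (intro same_component_edge) auto
        ultimately show ?thesis by blast
      qed
    qed (use X Y finY in auto)
    moreover have "card {z \<in> Y \<union> ?U. \<not> ?sc (hd T) z} \<le> card (Y \<union> ?U)"
      using finY by (intro card_mono) auto
    moreover have "card (Y \<union> ?U) \<le> r + card ?U" using card_Un_le[of Y ?U] Y(2) by linarith
    moreover have "card (set T \<union> set X) \<le> length T + r"
      using card_Un_le[of "set T" Y] X(1) Y(2) card_T by simp
    \<comment> \<open>The guess adds up to \<open>r\<close> vertices to the spanning forest, and
      attaching costs two edges for each element of \<open>Y\<close> and \<open>?U\<close>.\<close>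
    ultimately have "length F + 1 \<le> length T + 3 * r + 2 * card ?U" using X(2) by linarith
    then have "n * (length F + 1) \<le> n * (length T + 3 * r + 2 * card ?U)" by (rule mult_le_mono2)
    then have "n * length F + n \<le> n * length T + n * (3 * r) + 2 * n * card ?U"
      by (simp add: algebra_simps)
    moreover have "4 * (2 * n * card ?U) \<le> length T"
    proof -
      have "8 * n \<le> 2 ^ r" unfolding r_def by (rule less_imp_le[OF less_exp])
      then have "8 * n * card ?U \<le> 2 ^ r * card ?U" by (rule mult_le_mono1)
      also have "\<dots> \<le> length T" using Y(3) card_T by simp
      finally show ?thesis by simp
    qed
    moreover have "n * (3 * r) = 24 * n * n" by (simp add: r_def)
    moreover have "2 * (24 * n * n) + 1 \<le> length T" using False by simp
    \<comment> \<open>With \<open>t = |T|\<close> the excess is at most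
      \<open>(t - 1) / 2 + t / 4\<close>, and this is at most \<open>t - 1\<close> because
      \<open>t \<ge> 2\<close>.\<close>
    ultimately have "n * length F + n \<le> n * length T + (length T - 1)"
      using length_T_ge_2 by linarith
    also have "\<dots> \<le> n * Suc (opt_size I) + opt_size I"
      using T_le by (intro add_mono mult_le_mono2) auto
    finally show ?thesis by simp
  qed
qed

text \<open>Feasibility supplies a Steiner node, and then every completion is a solution.\<close>

lemma search_steiner_forest:
  fixes q :: nat
  assumes feas: "feasible I"
  defines "F \<equiv> search (diff vs T) q [] T (diff vs T) vs es"
  shows "\<exists>L. kinv (L, F)" and "steiner_forest I (uedges F)"
proof -
  have ne: "steiner_nodes I \<noteq> {}" using feas by (rule feasible_imp_steiner_nodes)
  obtain X where X: "set X \<subseteq> set (diff vs T)" "F = complete X T (diff vs T) vs es"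
    using search_complete[of "[]" "diff vs T" q T "diff vs T" vs es] by (auto simp: F_def)
  then show "\<exists>L. kinv (L, F)" "steiner_forest I (uedges F)"
    using complete_steiner_forest(1,2)[OF ne, of X] steiner_nodes_diff by auto
qed

end

section \<open>Guarantees for the whole algorithm\<close>

context dense_instance
begin

lemma solve_correct:
  assumes feas: "feasible I" and n: "n > 0"
  defines "F \<equiv> solve (200 * n * n) vs es ts"
  shows "lists_set (map (\<lambda>(u, v). {u, v}) F) (uedges F)" "steiner_forest I (uedges F)"
    "n * card (uedges F) \<le> (n + 1) * opt_size I"
proof -
  have "(\<exists>L. kinv (L, F)) \<and> steiner_forest I (uedges F) \<and> n * card (uedges F) \<le> (n + 1) * opt_size I"
  proof (cases "length D = 1 \<and> C = []")
    case True
    then obtain T where T: "D = [T]" by (auto simp: length_Suc_conv)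
    interpret single_terminal_set I vs es ts \<delta> T by unfold_locales (use T True in auto)
    have F: "F = search (diff vs T) (200 * n * n) [] T (diff vs T) vs es"
      using True T by (auto simp: F_def solve_def Let_def)
    obtain L where L: "kinv (L, F)" using search_steiner_forest(1)[OF feas] F by blast
    then have "card (uedges F) = length F" using kinv_card by fastforce
    then show ?thesis
      using L search_steiner_forest(2)[OF feas, of "200 * n * n"] search_approximates[OF feas n] F by auto
  next
    case False
    note opt = solve_groups_optimal[OF False]
    have F: "F = snd (add_groups (groups D C) es (singletons vs, []))"
      using False by (auto simp: F_def solve_def Let_def)
    then have "\<exists>L. kinv (L, F)" using opt by (metis prod.collapse)
    then show ?thesis using opt F by simp
  qed
  then show "lists_set (map (\<lambda>(u, v). {u, v}) F) (uedges F)" "steiner_forest I (uedges F)"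
    "n * card (uedges F) \<le> (n + 1) * opt_size I"
    by (auto simp: lists_set_def kinv_def uedges_def)
qed

text \<open>On a feasible instance the search branch would require a Steiner node, so the grouping
  branch is taken, which is exact.\<close>

lemma solve_exact:
  fixes q :: nat
  assumes feas: "feasible I" and no_steiner: "steiner_nodes I = {}"
  defines "F \<equiv> solve q vs es ts"
  shows "lists_set (map (\<lambda>(u, v). {u, v}) F) (uedges F)" "steiner_forest I (uedges F)"
    "card (uedges F) = opt_size I"
proof -
  have "\<not> (length D = 1 \<and> C = [])"
  proof
    assume *: "length D = 1 \<and> C = []"
    then obtain T where T: "D = [T]" by (auto simp: length_Suc_conv)
    interpret single_terminal_set I vs es ts \<delta> T by unfold_locales (use T * in auto)
    show False using feasible_imp_steiner_nodes feas no_steiner by blast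
  qed
  note opt = solve_groups_optimal[OF this]
  have F: "F = snd (add_groups (groups D C) es (singletons vs, []))"
    using \<open>\<not> (length D = 1 \<and> C = [])\<close> by (auto simp: F_def solve_def Let_def)
  then show "lists_set (map (\<lambda>(u, v). {u, v}) F) (uedges F)" "steiner_forest I (uedges F)"
    "card (uedges F) = opt_size I"
    using opt by (auto simp: lists_set_def kinv_def uedges_def)
qed

end

section \<open>Size of the output on arbitrary instances\<close>

context graph_lists
begin

lemma kinv_kruskal_inside: "kinv st \<Longrightarrow> kinv (kruskal (inside xs es) st)"
  using kruskal_inside(1) extends_kinv by blast

lemma kinv_connect: "kinv st \<Longrightarrow> kinv (connect t0 t ss es st)"
  by (induction ss) (auto simp: Let_def kinv_kruskal_inside)

lemma kinv_attach: "kinv st \<Longrightarrow> kinv (attach t0 ts ss es st)"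
  by (induction ts arbitrary: st) (auto simp: kinv_connect)

lemma kinv_complete: "\<exists>L. kinv (L, complete X T ss vs es)"
  using kinv_attach[OF kinv_kruskal_inside[OF kinv_init]] unfolding complete_def
  by (metis prod.collapse)

text \<open>The time bound must also hold on infeasible instances, about which the correctness
  results say nothing; the invariant controls the output there.\<close>

lemma kinv_solve: "\<exists>L. kinv (L, solve q vs es ts)"
proof (cases "length (disconnected_sets vs es ts) = 1 \<and> connected_sets vs es ts = []")
  case True
  then show ?thesis
    using kinv_complete search_complete unfolding solve_def by (auto simp: Let_def) metis
next
  case False
  have "kinv (add_groups gs es (singletons vs, []))" for gs
    using add_groups_extends[OF kinv_init] extends_kinv by blast
  then have "\<exists>L. kinv (L, snd (add_groups gs es (singletons vs, [])))" for gs
    by (metis prod.collapse)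
  then show ?thesis using False unfolding solve_def Let_def by (simp only: if_False)
qed

lemma solve_subset: "set (solve q vs es ts) \<subseteq> set es"
  using kinv_solve[of q ts] by (auto simp: kinv_def)

text \<open>The chosen edges are distinct as unordered pairs and all occur in
  \<open>es\<close>.\<close>

lemma kinv_length_le:
  assumes "kinv (L, F)"
  shows "length F \<le> length es"
proof -
  have "length F = card (uedges F)" using kinv_card[OF assms] by simp
  also have "\<dots> \<le> card (uedges es)"
    by (intro card_mono uedges_mono) (use assms in \<open>simp_all add: uedges_def kinv_def\<close>)
  also have "\<dots> \<le> length es"
    unfolding uedges_def by (metis card_image_le card_length finite_set le_trans)
  finally show ?thesis .
qed

lemma length_solve_le: "length (solve q vs es ts) \<le> length es"
  using kinv_solve[of q ts] kinv_length_le by blast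

end

section \<open>Symbolic execution of programs\<close>

text \<open>
  The equations for \<open>wp\<close> let the simplifier execute a function body symbolically. A call with a known
  \<open>computes\<close> fact is rewritten to its value and its \<open>run_time\<close>, which stays opaque and is
  bounded separately.
\<close>

definition wp :: "program \<Rightarrow> val list \<Rightarrow> exp \<Rightarrow> (val \<Rightarrow> nat \<Rightarrow> bool) \<Rightarrow> bool" where
  "wp p env e Q \<longleftrightarrow> (\<exists>v t. eval p env e v t \<and> Q v t)"

definition wps :: "program \<Rightarrow> val list \<Rightarrow> exp list \<Rightarrow> (val list \<Rightarrow> nat \<Rightarrow> bool) \<Rightarrow> bool" where
  "wps p env es Q \<longleftrightarrow> (\<exists>vs t. evals p env es vs t \<and> Q vs t)"

definition wp_call :: "program \<Rightarrow> nat \<Rightarrow> val list \<Rightarrow> (val \<Rightarrow> nat \<Rightarrow> bool) \<Rightarrow> bool" where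
  "wp_call p f vs Q \<longleftrightarrow> f < length p \<and> wp p vs (p ! f) Q"

text \<open>\<open>IsPair\<close> serves as the test for a nonempty list, the empty list being
  encoded by the leaf 0.\<close>

fun is_pair :: "val \<Rightarrow> nat" where
  "is_pair (NatV n) = 0"
| "is_pair (PairV v w) = 1"

lemma wp_Var [simp]: "wp p env (Var i) Q \<longleftrightarrow> i < length env \<and> Q (env ! i) 1"
  unfolding wp_def
  by (rule iffI; elim exE conjE) ((erule eval_VarE, force), blast intro: eval_Var)

lemma wp_Lit [simp]: "wp p env (Lit n) Q \<longleftrightarrow> Q (NatV n) 1"
  unfolding wp_def
  by (rule iffI; (elim exE conjE)?) ((erule eval_LitE, force), blast intro: eval_Lit)

lemma wp_Arith [simp]: "wp p env (Arith f a b) Q \<longleftrightarrow>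
    wp p env a (\<lambda>v s. wp p env b (\<lambda>w t. \<exists>m n. v = NatV m \<and> w = NatV n \<and>
      Q (NatV (arith_op f m n)) (s + t + 1)))"
  unfolding wp_def
  by (rule iffI; elim exE conjE) ((erule eval_ArithE, force), blast intro: eval_Arith)

lemma wp_MkPair [simp]: "wp p env (MkPair a b) Q \<longleftrightarrow>
    wp p env a (\<lambda>v s. wp p env b (\<lambda>w t. Q (PairV v w) (s + t + 1)))"
  unfolding wp_def
  by (rule iffI; elim exE conjE) ((erule eval_MkPairE, force), blast intro: eval_MkPair)

lemma wp_Fst [simp]: "wp p env (Fst a) Q \<longleftrightarrow> wp p env a (\<lambda>u s. \<exists>v w. u = PairV v w \<and> Q v (s + 1))"
  unfolding wp_def
  by (rule iffI; elim exE conjE) ((erule eval_FstE, force), blast intro: eval_Fst)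

lemma wp_Snd [simp]: "wp p env (Snd a) Q \<longleftrightarrow> wp p env a (\<lambda>u s. \<exists>v w. u = PairV v w \<and> Q w (s + 1))"
  unfolding wp_def
  by (rule iffI; elim exE conjE) ((erule eval_SndE, force), blast intro: eval_Snd)

lemma wp_IsPair [simp]: "wp p env (IsPair a) Q \<longleftrightarrow> wp p env a (\<lambda>u s. Q (NatV (is_pair u)) (s + 1))"
proof
  assume "wp p env (IsPair a) Q"
  then show "wp p env a (\<lambda>u s. Q (NatV (is_pair u)) (s + 1))"
    unfolding wp_def by (force elim: eval_IsPairE)
next
  assume "wp p env a (\<lambda>u s. Q (NatV (is_pair u)) (s + 1))"
  then obtain u s where "eval p env a u s" "Q (NatV (is_pair u)) (s + 1)" by (auto simp: wp_def)
  then show "wp p env (IsPair a) Q"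
    unfolding wp_def by (cases u) (force intro: eval_IsPair_pair eval_IsPair_nat)+
qed

lemma wp_IfNonzero [simp]: "wp p env (IfNonzero a b c) Q \<longleftrightarrow>
    wp p env a (\<lambda>u s. \<exists>n. u = NatV n \<and>
      (if n \<noteq> 0 then wp p env b (\<lambda>v t. Q v (s + t + 1)) else wp p env c (\<lambda>v t. Q v (s + t + 1))))"
  (is "?L \<longleftrightarrow> ?R")
proof
  assume ?L
  then show ?R unfolding wp_def by (force elim: eval_IfE)
next
  assume ?R
  then obtain n s where n: "eval p env a (NatV n) s"
    "if n \<noteq> 0 then wp p env b (\<lambda>v t. Q v (s + t + 1)) else wp p env c (\<lambda>v t. Q v (s + t + 1))"
    by (auto simp: wp_def)
  show ?L
  proof (cases "n = 0")
    case True
    then obtain v t where "eval p env c v t" "Q v (s + t + 1)" using n(2) by (auto simp: wp_def)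
    then show ?thesis using n(1)[unfolded True] unfolding wp_def by (blast intro: eval_If_zero)
  next
    case False
    then obtain v t where "eval p env b v t" "Q v (s + t + 1)" using n(2) by (auto simp: wp_def)
    then show ?thesis using n(1) False unfolding wp_def by (blast intro: eval_If_nonzero)
  qed
qed

lemma wp_LetIn [simp]: "wp p env (LetIn a b) Q \<longleftrightarrow>
    wp p env a (\<lambda>v s. wp p (v # env) b (\<lambda>w t. Q w (s + t + 1)))"
  unfolding wp_def
  by (rule iffI; elim exE conjE) ((erule eval_LetE, force), blast intro: eval_Let)

lemma wp_Call [simp]: "wp p env (Call f as) Q \<longleftrightarrow>
    wps p env as (\<lambda>vs s. wp_call p f vs (\<lambda>w t. Q w (s + t + 1)))"
  unfolding wp_def wps_def wp_call_def
  by (rule iffI; elim exE conjE) ((erule eval_CallE, force), blast intro: eval_Call)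

lemma wps_Nil [simp]: "wps p env [] Q \<longleftrightarrow> Q [] 0"
  by (auto simp: wps_def intro: evals_Nil elim: evals_NilE)

lemma wps_Cons [simp]: "wps p env (a # as) Q \<longleftrightarrow>
    wp p env a (\<lambda>v s. wps p env as (\<lambda>vs t. Q (v # vs) (s + t)))"
  unfolding wp_def wps_def
  by (rule iffI; elim exE conjE) ((erule evals_ConsE, force), blast intro: evals_Cons)

definition computes :: "program \<Rightarrow> nat \<Rightarrow> val list \<Rightarrow> val \<Rightarrow> nat \<Rightarrow> bool" where
  "computes p f vs v b \<longleftrightarrow> wp_call p f vs (\<lambda>w t. w = v \<and> t \<le> b)"

definition run_time :: "program \<Rightarrow> nat \<Rightarrow> val list \<Rightarrow> nat" where
  "run_time p f vs = (THE t. \<exists>v. eval p vs (p ! f) v t)"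

lemma computes_iff: "computes p f vs v b \<longleftrightarrow> f < length p \<and> (\<exists>t\<le>b. eval p vs (p ! f) v t)"
  by (auto simp: computes_def wp_call_def wp_def)

lemma computes_eval:
  assumes "computes p f vs v b"
  shows "eval p vs (p ! f) v (run_time p f vs)"
proof -
  obtain t where t: "eval p vs (p ! f) v t" using assms by (auto simp: computes_iff)
  then have "run_time p f vs = t"
    unfolding run_time_def using eval_deterministic(1)[OF t] by (intro the_equality) blast+
  then show ?thesis using t by simp
qed

lemma run_time_le:
  assumes "computes p f vs v b"
  shows "run_time p f vs \<le> b"
  using assms eval_deterministic(1)[OF computes_eval[OF assms]] by (auto simp: computes_iff)

text \<open>By determinism of \<open>eval\<close> a call has a single outcome, so the equivalence
  holds for every postcondition and can be used for rewriting.\<close>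

lemma wp_call_iff:
  assumes "computes p f vs v b"
  shows "wp_call p f vs Q \<longleftrightarrow> Q v (run_time p f vs)"
  using assms computes_eval[OF assms] eval_deterministic(1)[OF computes_eval[OF assms]]
  unfolding wp_call_def computes_iff wp_def by blast

lemma computes_mono: "computes p f vs v b \<Longrightarrow> b \<le> b' \<Longrightarrow> computes p f vs v b'"
  unfolding computes_iff using le_trans by blast

section \<open>The program\<close>

fun pair_val :: "nat \<times> nat \<Rightarrow> val" where
  "pair_val (u, v) = PairV (NatV u) (NatV v)"

abbreviation nats_val :: "nat list \<Rightarrow> val" where "nats_val \<equiv> list_val NatV"
abbreviation pairs_val :: "(nat \<times> nat) list \<Rightarrow> val" where "pairs_val \<equiv> list_val pair_val"
abbreviation sets_val :: "nat list list \<Rightarrow> val" where "sets_val \<equiv> list_val (list_val NatV)"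

abbreviation state_val :: "kstate \<Rightarrow> val" where
  "state_val st \<equiv> PairV (pairs_val (fst st)) (pairs_val (snd st))"

\<comment> \<open>\<open>Suc 0\<close> is the simplifier's normal form of \<open>1\<close>, so that facts about calls still match.\<close>
abbreviation (input) "MUL \<equiv> Suc 0 :: nat"
abbreviation (input) "MEM \<equiv> 2 :: nat"
abbreviation (input) "INSIDE \<equiv> 3 :: nat"
abbreviation (input) "LOOKUP \<equiv> 4 :: nat"
abbreviation (input) "RELABEL \<equiv> 5 :: nat"
abbreviation (input) "KRUSKAL \<equiv> 6 :: nat"
abbreviation (input) "SINGLETONS \<equiv> 7 :: nat"
abbreviation (input) "ALL_LABEL \<equiv> 8 :: nat"
abbreviation (input) "APPEND \<equiv> 9 :: nat"
abbreviation (input) "CONNECTED \<equiv> 10 :: nat"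
abbreviation (input) "SPLIT \<equiv> 11 :: nat"
abbreviation (input) "GROUPS \<equiv> 12 :: nat"
abbreviation (input) "ADD_GROUPS \<equiv> 13 :: nat"
abbreviation (input) "CONNECT \<equiv> 14 :: nat"
abbreviation (input) "ATTACH \<equiv> 15 :: nat"
abbreviation (input) "DIFF \<equiv> 16 :: nat"
abbreviation (input) "LENGTH \<equiv> 17 :: nat"
abbreviation (input) "COMPLETE \<equiv> 18 :: nat"
abbreviation (input) "SEARCH \<equiv> 19 :: nat"
abbreviation (input) "GROUPED \<equiv> 20 :: nat"
abbreviation (input) "SOLVE \<equiv> 21 :: nat"

definition "mem_body =
  IfNonzero (IsPair (Var 1))
    (IfNonzero (Arith Equal (Var 0) (Fst (Var 1))) (Lit 1) (Call MEM [Var 0, Snd (Var 1)]))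
    (Lit 0)"

definition "inside_body =
  IfNonzero (IsPair (Var 1))
    (IfNonzero (Call MEM [Fst (Fst (Var 1)), Var 0])
      (IfNonzero (Call MEM [Snd (Fst (Var 1)), Var 0])
        (MkPair (Fst (Var 1)) (Call INSIDE [Var 0, Snd (Var 1)]))
        (Call INSIDE [Var 0, Snd (Var 1)]))
      (Call INSIDE [Var 0, Snd (Var 1)]))
    (Lit 0)"

definition "lookup_body =
  IfNonzero (IsPair (Var 1))
    (IfNonzero (Arith Equal (Fst (Fst (Var 1))) (Var 0))
      (Snd (Fst (Var 1)))
      (Call LOOKUP [Var 0, Snd (Var 1)]))
    (Lit 0)"

definition "relabel_body =
  IfNonzero (IsPair (Var 2))
    (MkPair
      (MkPair (Fst (Fst (Var 2)))
        (IfNonzero (Arith Equal (Snd (Fst (Var 2))) (Var 0)) (Var 1) (Snd (Fst (Var 2)))))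
      (Call RELABEL [Var 0, Var 1, Snd (Var 2)]))
    (Lit 0)"

text \<open>\<open>Var 0\<close> and \<open>Var 1\<close> start as the edge list and the state. Each
  \<open>LetIn\<close> shifts indices by one; below both, the labels of the two ends are
  \<open>Var 1\<close> and \<open>Var 0\<close>, the list is \<open>Var 2\<close> and the state
  \<open>Var 3\<close>.\<close>

definition "kruskal_body =
  IfNonzero (IsPair (Var 0))
    (LetIn (Call LOOKUP [Fst (Fst (Var 0)), Fst (Var 1)])
      (LetIn (Call LOOKUP [Snd (Fst (Var 1)), Fst (Var 2)])
        (IfNonzero (Arith Equal (Var 1) (Var 0))
          (Call KRUSKAL [Snd (Var 2), Var 3])
          (Call KRUSKAL [Snd (Var 2),
            MkPair (Call RELABEL [Var 1, Var 0, Fst (Var 3)])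
              (MkPair (Fst (Var 2)) (Snd (Var 3)))]))))
    (Var 1)"

definition "singletons_body =
  IfNonzero (IsPair (Var 0))
    (MkPair (MkPair (Fst (Var 0)) (Fst (Var 0))) (Call SINGLETONS [Snd (Var 0)]))
    (Lit 0)"

definition "all_label_body =
  IfNonzero (IsPair (Var 1))
    (IfNonzero (Arith Equal (Call LOOKUP [Fst (Var 1), Var 2]) (Var 0))
      (Call ALL_LABEL [Var 0, Snd (Var 1), Var 2])
      (Lit 0))
    (Lit 1)"

definition "append_body =
  IfNonzero (IsPair (Var 0))
    (MkPair (Fst (Var 0)) (Call APPEND [Snd (Var 0), Var 1]))
    (Var 1)"

definition "connected_body =
  LetIn (Fst (Call KRUSKAL [Call INSIDE [Var 2, Var 1], MkPair (Call SINGLETONS [Var 0]) (Lit 0)]))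
    (Call ALL_LABEL [Call LOOKUP [Fst (Var 3), Var 0], Var 3, Var 0])"

text \<open>One pass returns the disconnected and the connected sets as a pair, so connectivity of
  each set is tested once.\<close>

definition "split_body =
  IfNonzero (IsPair (Var 0))
    (LetIn (Call SPLIT [Snd (Var 0), Var 1, Var 2])
      (IfNonzero (IsPair (Fst (Var 1)))
        (IfNonzero (Call CONNECTED [Var 2, Var 3, Fst (Var 1)])
          (MkPair (Fst (Var 0)) (MkPair (Fst (Var 1)) (Snd (Var 0))))
          (MkPair (MkPair (Fst (Var 1)) (Fst (Var 0))) (Snd (Var 0))))
        (Var 0)))
    (MkPair (Lit 0) (Lit 0))"

definition "groups_body =
  IfNonzero (IsPair (Var 0))
    (IfNonzero (IsPair (Snd (Var 0)))
      (Call GROUPS [Snd (Snd (Var 0)),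
        MkPair (Call APPEND [Fst (Var 0), Fst (Snd (Var 0))]) (Var 1)])
      (IfNonzero (IsPair (Var 1))
        (MkPair (Call APPEND [Fst (Var 0), Fst (Var 1)]) (Snd (Var 1)))
        (Var 0)))
    (Var 1)"

definition "add_groups_body =
  IfNonzero (IsPair (Var 0))
    (Call ADD_GROUPS [Snd (Var 0), Var 1,
      Call KRUSKAL [Call INSIDE [Fst (Var 0), Var 1], Var 2]])
    (Var 2)"

definition "connect_body =
  IfNonzero (IsPair (Var 2))
    (LetIn (Call KRUSKAL
        [Call INSIDE [MkPair (Var 0) (MkPair (Fst (Var 2)) (MkPair (Var 1) (Lit 0))), Var 3], Var 4])
      (IfNonzero (Arith Equal (Call LOOKUP [Var 1, Fst (Var 0)]) (Call LOOKUP [Var 2, Fst (Var 0)]))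
        (Var 0)
        (Call CONNECT [Var 1, Var 2, Snd (Var 3), Var 4, Var 5])))
    (Var 4)"

definition "attach_body =
  IfNonzero (IsPair (Var 1))
    (Call ATTACH [Var 0, Snd (Var 1), Var 2, Var 3,
      IfNonzero (Arith Equal (Call LOOKUP [Var 0, Fst (Var 4)]) (Call LOOKUP [Fst (Var 1), Fst (Var 4)]))
        (Var 4)
        (Call CONNECT [Var 0, Fst (Var 1), Var 2, Var 3, Var 4])])
    (Var 4)"

definition "diff_body =
  IfNonzero (IsPair (Var 0))
    (IfNonzero (Call MEM [Fst (Var 0), Var 1])
      (Call DIFF [Snd (Var 0), Var 1])
      (MkPair (Fst (Var 0)) (Call DIFF [Snd (Var 0), Var 1])))
    (Lit 0)"

definition "length_body =
  IfNonzero (IsPair (Var 0)) (Arith Plus (Lit 1) (Call LENGTH [Snd (Var 0)])) (Lit 0)"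

definition "complete_body =
  Snd (Call ATTACH [Fst (Var 1), Var 1, Var 2, Var 4,
    Call KRUSKAL [Call INSIDE [Call APPEND [Var 1, Var 0], Var 4],
      MkPair (Call SINGLETONS [Var 3]) (Lit 0)]])"

text \<open>The HOL \<open>let\<close> is mere notation and produces no \<open>LetIn\<close>. Both
  copies of \<open>leaf\<close> stand in the unshifted environment, so their indices agree.\<close>

definition "search_body =
  (let leaf = Call COMPLETE [Var 2, Var 3, Var 4, Var 5, Var 6]
   in IfNonzero (IsPair (Var 0))
     (IfNonzero (Var 1)
       (LetIn (Call SEARCH [Snd (Var 0), Var 1, Var 2, Var 3, Var 4, Var 5, Var 6])
         (LetIn (Call SEARCH [Snd (Var 1), Arith Minus (Var 2) (Lit 1), MkPair (Fst (Var 1)) (Var 3),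
             Var 4, Var 5, Var 6, Var 7])
           (IfNonzero (Arith Less (Call LENGTH [Var 1]) (Call LENGTH [Var 0])) (Var 1) (Var 0))))
       leaf)
     leaf)"

definition "grouped_body =
  Snd (Call ADD_GROUPS [Call GROUPS [Fst (Var 0), Snd (Var 0)], Fst (Snd (Var 1)),
    MkPair (Call SINGLETONS [Fst (Var 1)]) (Lit 0)])"

text \<open>All three copies of \<open>rest\<close> stand directly below the outer
  \<open>LetIn\<close>. The nested tests recognise exactly one disconnected and no connected set
  without computing a length.\<close>

definition "solve_body =
  LetIn (Call SPLIT [Snd (Snd (Var 1)), Fst (Var 1), Fst (Snd (Var 1))])
    (let rest = Call GROUPED [Var 0, Var 2]
     in IfNonzero (IsPair (Fst (Var 0)))
       (IfNonzero (IsPair (Snd (Fst (Var 0))))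
         rest
         (IfNonzero (IsPair (Snd (Var 0)))
           rest
           (LetIn (Call DIFF [Fst (Var 2), Fst (Fst (Var 0))])
             (Call SEARCH [Var 0, Var 2, Lit 0, Fst (Fst (Var 1)), Var 0, Fst (Var 3), Fst (Snd (Var 3))]))))
       rest)"

text \<open>The machine has no multiplication; the first argument counts repeated additions.\<close>

definition "mul_body =
  IfNonzero (Var 0) (Arith Plus (Var 1) (Call MUL [Arith Minus (Var 0) (Lit 1), Var 1])) (Lit 0)"

text \<open>\<open>runs\<close> starts at position 0; the remaining order matches the index
  abbreviations. No other function calls position 0, so facts about them hold for every
  \<open>main\<close> and serve both programs.\<close>

definition program_with_main :: "exp \<Rightarrow> program" where
  "program_with_main main = [main, mul_body, mem_body, inside_body, lookup_body, relabel_body, kruskal_body,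
     singletons_body, all_label_body, append_body, connected_body, split_body, groups_body,
     add_groups_body, connect_body, attach_body, diff_body, length_body, complete_body, search_body,
     grouped_body, solve_body]"

section \<open>Running times\<close>

lemma inside_Nil [simp]: "inside xs [] = []"
  by (simp add: inside_def)

lemma inside_Cons: "inside xs ((u, v) # es) =
    (if u \<in> set xs \<and> v \<in> set xs then (u, v) # inside xs es else inside xs es)"
  by (simp add: inside_def)

lemma length_inside: "length (inside xs es) \<le> length es"
  by (simp add: inside_def)

lemma length_fst_kruskal [simp]: "length (fst (kruskal es st)) = length (fst st)"
  by (induction es st rule: kruskal.induct) (auto simp: relabel_def)

lemma length_fst_connect [simp]: "length (fst (connect t0 t ss es st)) = length (fst st)"
  by (induction ss) (auto simp: Let_def)

lemma disconnected_sets_Nil [simp]: "disconnected_sets vs es [] = []"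
  and connected_sets_Nil [simp]: "connected_sets vs es [] = []"
  by (simp_all add: disconnected_sets_def connected_sets_def)

lemma disconnected_sets_Cons: "disconnected_sets vs es (T # ts) =
    (if T \<noteq> [] \<and> \<not> connected_list vs es T then T # disconnected_sets vs es ts
     else disconnected_sets vs es ts)"
  and connected_sets_Cons: "connected_sets vs es (T # ts) =
    (if T \<noteq> [] \<and> connected_list vs es T then T # connected_sets vs es ts
     else connected_sets vs es ts)"
  by (simp_all add: disconnected_sets_def connected_sets_def)

lemma length_le_concat: "x \<in> set xs \<Longrightarrow> length x \<le> length (concat xs)"
  by (induction xs) auto

lemma length_concat_sets:
  "length (concat (disconnected_sets vs es ts)) + length (concat (connected_sets vs es ts)) =
     length (concat ts)"
  by (induction ts) (auto simp: disconnected_sets_Cons connected_sets_Cons)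

lemma length_sets:
  "length (disconnected_sets vs es ts) + length (connected_sets vs es ts) \<le> length ts"
  by (induction ts) (auto simp: disconnected_sets_Cons connected_sets_Cons)

lemma length_concat_groups: "length (concat (groups D C)) = length (concat D) + length (concat C)"
  by (induction D C rule: groups.induct) auto

lemma length_groups_le: "length (groups D C) \<le> length D + length C"
  by (induction D C rule: groups.induct) auto

text \<open>The number of calls in the recursion tree of \<open>search\<close> for \<open>n\<close>
  remaining candidates and budget \<open>q\<close>.\<close>

fun search_nodes :: "nat \<Rightarrow> nat \<Rightarrow> nat" where
  "search_nodes 0 q = 1"
| "search_nodes (Suc n) q =
     (if q = 0 then 1 else 1 + search_nodes n q + search_nodes n (q - 1))"

text \<open>Adding 1 turns the recurrence into a plain sum of the two earlier values, as for partial
  sums of binomial coefficients. The exponent is the budget alone.\<close>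

lemma search_nodes_le: "search_nodes n q + 1 \<le> 2 * (n + 1) ^ q"
proof (induction n q rule: search_nodes.induct)
  case (2 n q)
  show ?case
  proof (cases q)
    case (Suc r)
    have "search_nodes (Suc n) q + 1 \<le> 2 * ((n + 1) ^ Suc r + (n + 1) ^ r)"
      using 2 Suc by simp
    also have "(n + 1) ^ Suc r + (n + 1) ^ r = (n + 2) * (n + 1) ^ r" by simp
    also have "\<dots> \<le> (n + 2) * (n + 2) ^ r" by (intro mult_le_mono2 power_mono) auto
    finally show ?thesis using Suc by simp
  qed simp
qed simp

text \<open>In the cost functions \<open>N\<close> bounds the lengths of the lists involved. A loop
  takes at most \<open>N + 1\<close> rounds, including the one for the empty list; the constants per
  round are generous.\<close>

definition "lin N = 30 * (N + 1)" for N :: nat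
definition "inside_cost N = (N + 1) * (2 * lin N + 40)"
definition "kruskal_cost N = (N + 1) * (3 * lin N + 60)"
definition "label_cost N = (N + 1) * (lin N + 40)"
definition "connected_cost N = inside_cost N + kruskal_cost N + label_cost N + 2 * lin N + 60"
definition "split_cost N = (N + 1) * (connected_cost N + 60)"
definition "groups_cost N = (N + 1) * (lin N + 60)"
definition "add_groups_cost N = (N + 1) * (inside_cost N + kruskal_cost N + 60)"
definition "connect_cost N = (N + 1) * (inside_cost N + kruskal_cost N + 2 * lin N + 60)"
definition "attach_cost N = (N + 1) * (connect_cost N + 2 * lin N + 60)"
definition "diff_cost N = (N + 1) * (lin N + 40)"
text \<open>The doubled argument is due to the vertex list \<open>T @ X\<close>, whose length may
  reach \<open>2 * N\<close>.\<close>

definition "complete_cost N =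
  2 * lin N + inside_cost (2 * N) + kruskal_cost N + attach_cost N + 60"
definition "search_cost q N = (complete_cost N + 2 * lin N + 80) * (2 * (N + 1) ^ q)"
definition "grouped_cost N = groups_cost N + add_groups_cost N + lin N + 60"
definition "solve_cost q N =
  split_cost N + grouped_cost N + diff_cost N + search_cost q N + 80"

context
  fixes main :: exp and P :: program
  defines "P \<equiv> program_with_main main"
begin

lemma computesI:
  "f < 22 \<Longrightarrow> wp P vs (program_with_main main ! f) (\<lambda>w t. w = v \<and> t \<le> b) \<Longrightarrow> computes P f vs v b"
  by (simp add: computes_def wp_call_def P_def program_with_main_def)

lemma mul_computes: "computes P MUL [NatV a, NatV b] (NatV (a * b)) (30 * (a + 1))"
proof (induction a)
  case 0
  show ?case by (rule computesI) (simp_all add: program_with_main_def mul_body_def)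
next
  case (Suc a)
  show ?case
    using run_time_le[OF Suc.IH]
    by (intro computesI) (auto simp: program_with_main_def mul_body_def wp_call_iff[OF Suc.IH])
qed

lemma mem_computes:
  assumes "length xs \<le> N"
  shows "computes P MEM [NatV x, nats_val xs] (NatV (of_bool (x \<in> set xs))) (lin N)"
proof -
  have "computes P MEM [NatV x, nats_val xs] (NatV (of_bool (x \<in> set xs))) (30 * (length xs + 1))"
  proof (induction xs)
    case Nil
    show ?case by (rule computesI) (simp_all add: program_with_main_def mem_body_def)
  next
    case (Cons a xs)
    show ?case
      using run_time_le[OF Cons.IH]
      by (intro computesI) (auto simp: program_with_main_def mem_body_def wp_call_iff[OF Cons.IH])
  qed
  then show ?thesis by (rule computes_mono) (use assms in \<open>simp add: lin_def\<close>)
qed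

lemma lookup_computes:
  assumes "length L \<le> N"
  shows "computes P LOOKUP [NatV x, pairs_val L] (NatV (lookup x L)) (lin N)"
proof -
  have "computes P LOOKUP [NatV x, pairs_val L] (NatV (lookup x L)) (30 * (length L + 1))"
  proof (induction L)
    case Nil
    show ?case by (rule computesI) (simp_all add: program_with_main_def lookup_body_def)
  next
    case (Cons e L)
    obtain u v where "e = (u, v)" by fastforce
    then show ?case
      using run_time_le[OF Cons.IH]
      by (intro computesI) (auto simp: program_with_main_def lookup_body_def wp_call_iff[OF Cons.IH])
  qed
  then show ?thesis by (rule computes_mono) (use assms in \<open>simp add: lin_def\<close>)
qed

lemma relabel_computes:
  assumes "length L \<le> N"
  shows "computes P RELABEL [NatV a, NatV b, pairs_val L] (pairs_val (relabel a b L)) (lin N)"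
proof -
  have "computes P RELABEL [NatV a, NatV b, pairs_val L] (pairs_val (relabel a b L)) (30 * (length L + 1))"
  proof (induction L)
    case Nil
    show ?case by (rule computesI) (simp_all add: program_with_main_def relabel_body_def relabel_def)
  next
    case (Cons e L)
    obtain u v where "e = (u, v)" by fastforce
    then show ?case
      using run_time_le[OF Cons.IH]
      by (intro computesI)
        (auto simp: program_with_main_def relabel_body_def wp_call_iff[OF Cons.IH] relabel_def)
  qed
  then show ?thesis by (rule computes_mono) (use assms in \<open>simp add: lin_def\<close>)
qed

lemma singletons_computes:
  assumes "length vs \<le> N"
  shows "computes P SINGLETONS [nats_val vs] (pairs_val (singletons vs)) (lin N)"
proof -
  have "computes P SINGLETONS [nats_val vs] (pairs_val (singletons vs)) (30 * (length vs + 1))"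
  proof (induction vs)
    case Nil
    show ?case
      by (rule computesI) (simp_all add: program_with_main_def singletons_body_def singletons_def)
  next
    case (Cons a vs)
    show ?case
      using run_time_le[OF Cons.IH]
      by (intro computesI)
        (auto simp: program_with_main_def singletons_body_def wp_call_iff[OF Cons.IH] singletons_def)
  qed
  then show ?thesis by (rule computes_mono) (use assms in \<open>simp add: lin_def\<close>)
qed

lemma append_computes:
  assumes "length xs \<le> N"
  shows "computes P APPEND [nats_val xs, nats_val ys] (nats_val (xs @ ys)) (lin N)"
proof -
  have "computes P APPEND [nats_val xs, nats_val ys] (nats_val (xs @ ys)) (30 * (length xs + 1))"
  proof (induction xs)
    case Nil
    show ?case by (rule computesI) (simp_all add: program_with_main_def append_body_def)
  next
    case (Cons a xs)
    show ?case
      using run_time_le[OF Cons.IH]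
      by (intro computesI) (auto simp: program_with_main_def append_body_def wp_call_iff[OF Cons.IH])
  qed
  then show ?thesis by (rule computes_mono) (use assms in \<open>simp add: lin_def\<close>)
qed

lemma length_computes:
  assumes "length xs \<le> N"
  shows "computes P LENGTH [pairs_val xs] (NatV (length xs)) (lin N)"
proof -
  have "computes P LENGTH [pairs_val xs] (NatV (length xs)) (30 * (length xs + 1))"
  proof (induction xs)
    case Nil
    show ?case by (rule computesI) (simp_all add: program_with_main_def length_body_def)
  next
    case (Cons a xs)
    show ?case
      using run_time_le[OF Cons.IH]
      by (intro computesI) (auto simp: program_with_main_def length_body_def wp_call_iff[OF Cons.IH])
  qed
  then show ?thesis by (rule computes_mono) (use assms in \<open>simp add: lin_def\<close>)
qed

lemma inside_computes:
  assumes "length xs \<le> N" "length es \<le> N"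
  shows "computes P INSIDE [nats_val xs, pairs_val es] (pairs_val (inside xs es)) (inside_cost N)"
proof -
  \<comment> \<open>The cost of one round stays abstract while the body is executed and is unfolded
    for the final inequality; the later loops proceed alike.\<close>
  define K where "K = 2 * lin N + 40"
  have "computes P INSIDE [nats_val xs, pairs_val es] (pairs_val (inside xs es)) ((length es + 1) * K)"
  proof (induction es)
    case Nil
    show ?case by (rule computesI) (simp_all add: program_with_main_def inside_body_def K_def)
  next
    case (Cons e es)
    obtain u v where e: "e = (u, v)" by fastforce
    note calls = Cons.IH mem_computes[OF assms(1), of u] mem_computes[OF assms(1), of v]
    show ?case
      using calls[THEN run_time_le] unfolding e
      by (intro computesI)
        (auto simp: program_with_main_def inside_body_def calls[THEN wp_call_iff] inside_Cons K_def[symmetric],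
         auto simp: K_def)
  qed
  then show ?thesis
    by (rule computes_mono) (use assms(2) in \<open>simp add: inside_cost_def K_def\<close>)
qed

text \<open>Relabelling keeps the length of the table, so \<open>N\<close> bounds every lookup of
  the run.\<close>

lemma kruskal_computes:
  assumes "length (fst st) \<le> N" "length es \<le> N"
  shows "computes P KRUSKAL [pairs_val es, state_val st] (state_val (kruskal es st)) (kruskal_cost N)"
proof -
  define K where "K = 3 * lin N + 60"
  have "computes P KRUSKAL [pairs_val es, state_val st] (state_val (kruskal es st)) ((length es + 1) * K)"
    using assms(1)
  proof (induction es arbitrary: st)
    case Nil
    show ?case by (rule computesI) (simp_all add: program_with_main_def kruskal_body_def K_def)
  next
    case (Cons e es)
    obtain u v where e: "e = (u, v)" by fastforce
    obtain L F where st: "st = (L, F)" by fastforce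
    have L: "length L \<le> N" using Cons.prems st by simp
    let ?a = "lookup u L" and ?b = "lookup v L"
    have "computes P KRUSKAL [pairs_val es, state_val (L, F)] (state_val (kruskal es (L, F)))
        ((length es + 1) * K)"
      by (rule Cons.IH) (simp add: L)
    moreover have "computes P KRUSKAL [pairs_val es, state_val (relabel ?a ?b L, (u, v) # F)]
        (state_val (kruskal es (relabel ?a ?b L, (u, v) # F))) ((length es + 1) * K)"
      by (rule Cons.IH) (simp add: L relabel_def)
    \<comment> \<open>The hypotheses are restated in the pair form that symbolic execution produces,
      so that they match the calls.\<close>
    ultimately have IH:
      "computes P KRUSKAL [pairs_val es, PairV (pairs_val L) (pairs_val F)]
        (state_val (kruskal es (L, F))) ((length es + 1) * K)"
      "computes P KRUSKAL [pairs_val es, PairV (pairs_val (relabel ?a ?b L))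
          (PairV (PairV (NatV u) (NatV v)) (pairs_val F))]
        (state_val (kruskal es (relabel ?a ?b L, (u, v) # F))) ((length es + 1) * K)"
      by simp_all
    note calls = IH lookup_computes[OF L, of u] lookup_computes[OF L, of v]
      relabel_computes[OF L, of ?a ?b]
    show ?case
      using calls[THEN run_time_le] unfolding e st
      by (intro computesI)
        (auto simp: program_with_main_def kruskal_body_def calls[THEN wp_call_iff] K_def[symmetric],
         auto simp: K_def)
  qed
  then show ?thesis
    by (rule computes_mono) (use assms(2) in \<open>simp add: kruskal_cost_def K_def\<close>)
qed

lemma all_label_computes:
  assumes "length ts \<le> N" "length L \<le> N"
  shows "computes P ALL_LABEL [NatV a, nats_val ts, pairs_val L] (NatV (of_bool (all_label a ts L)))
    (label_cost N)"
proof -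
  define K where "K = lin N + 40"
  have "computes P ALL_LABEL [NatV a, nats_val ts, pairs_val L] (NatV (of_bool (all_label a ts L)))
    ((length ts + 1) * K)"
  proof (induction ts)
    case Nil
    show ?case
      by (rule computesI) (simp_all add: program_with_main_def all_label_body_def all_label_def K_def)
  next
    case (Cons t ts)
    note calls = Cons.IH lookup_computes[OF assms(2), of t]
    show ?case
      using calls[THEN run_time_le]
      by (intro computesI)
        (auto simp: program_with_main_def all_label_body_def calls[THEN wp_call_iff] all_label_def
          K_def[symmetric], auto simp: K_def)
  qed
  then show ?thesis
    by (rule computes_mono) (use assms(1) in \<open>simp add: label_cost_def K_def\<close>)
qed

lemma connected_computes:
  assumes "T \<noteq> []" "length vs \<le> N" "length es \<le> N" "length T \<le> N"
  shows "computes P CONNECTED [nats_val vs, pairs_val es, nats_val T]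
    (NatV (of_bool (connected_list vs es T))) (connected_cost N)"
proof -
  obtain t T' where T: "T = t # T'" using assms(1) by (cases T) auto
  let ?L = "fst (kruskal (inside T es) (singletons vs, []))"
  have L: "length ?L \<le> N" "length (singletons vs) \<le> N" "length (inside T es) \<le> N"
    using assms length_inside[of T es] by (simp_all add: singletons_def)
  have "computes P KRUSKAL [pairs_val (inside T es), state_val (singletons vs, [])]
      (state_val (kruskal (inside T es) (singletons vs, []))) (kruskal_cost N)"
    by (rule kruskal_computes) (use L in auto)
  note calls = this inside_computes[OF assms(4,3)] singletons_computes[OF assms(2)]
    lookup_computes[OF L(1), of t] all_label_computes[OF assms(4) L(1), of "lookup t ?L"]
  note calls = calls[unfolded T, simplified]
  show ?thesis
    using calls[THEN run_time_le]
    by (intro computesI) (simp_all add: program_with_main_def connected_body_def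
        calls[THEN wp_call_iff] connected_cost_def connected_list_def T Let_def)
qed

lemma split_computes:
  assumes "length vs \<le> N" "length es \<le> N" "\<And>T. T \<in> set ts \<Longrightarrow> length T \<le> N" "length ts \<le> N"
  shows "computes P SPLIT [sets_val ts, nats_val vs, pairs_val es]
    (PairV (sets_val (disconnected_sets vs es ts)) (sets_val (connected_sets vs es ts))) (split_cost N)"
proof -
  define K where "K = connected_cost N + 60"
  have "computes P SPLIT [sets_val ts, nats_val vs, pairs_val es]
    (PairV (sets_val (disconnected_sets vs es ts)) (sets_val (connected_sets vs es ts)))
    ((length ts + 1) * K)"
    using assms(3)
  proof (induction ts)
    case Nil
    show ?case by (rule computesI) (simp_all add: program_with_main_def split_body_def K_def)
  next
    case (Cons T ts)
    have IH: "computes P SPLIT [sets_val ts, nats_val vs, pairs_val es]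
      (PairV (sets_val (disconnected_sets vs es ts)) (sets_val (connected_sets vs es ts)))
      ((length ts + 1) * K)"
      using Cons by simp
    show ?case
    proof (cases T)
      case Nil
      then show ?thesis
        using run_time_le[OF IH]
        by (intro computesI)
          (auto simp: program_with_main_def split_body_def wp_call_iff[OF IH]
            disconnected_sets_Cons connected_sets_Cons K_def[symmetric], auto simp: K_def)
    next
      case T: (Cons t T')
      have "length T \<le> N" using Cons.prems by simp
      note calls = IH connected_computes[OF _ assms(1,2) this, unfolded T, simplified]
      show ?thesis
        using calls[THEN run_time_le] unfolding T
        by (intro computesI)
          (auto simp: program_with_main_def split_body_def calls[THEN wp_call_iff]
            disconnected_sets_Cons connected_sets_Cons K_def[symmetric], auto simp: K_def)
    qed
  qed
  then show ?thesis
    by (rule computes_mono) (use assms(4) in \<open>simp add: split_cost_def K_def\<close>)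
qed

lemma groups_computes:
  assumes "\<And>a. a \<in> set D \<Longrightarrow> length a \<le> N" "length D \<le> N"
  shows "computes P GROUPS [sets_val D, sets_val C] (sets_val (groups D C)) (groups_cost N)"
proof -
  define K where "K = lin N + 60"
  have "computes P GROUPS [sets_val D, sets_val C] (sets_val (groups D C)) ((length D + 1) * K)"
    using assms(1)
  proof (induction D C rule: groups.induct)
    case (1 C)
    show ?case by (rule computesI) (simp_all add: program_with_main_def groups_body_def K_def)
  next
    case (2 a)
    show ?case by (rule computesI) (simp_all add: program_with_main_def groups_body_def K_def)
  next
    case (3 a g C)
    then have call: "computes P APPEND [nats_val a, nats_val g] (nats_val (a @ g)) (lin N)"
      by (intro append_computes) simp
    show ?case
      using run_time_le[OF call]
      by (intro computesI)
        (simp_all add: program_with_main_def groups_body_def wp_call_iff[OF call] K_def)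
  next
    case (4 a b D C)
    have IH: "computes P GROUPS [sets_val D, sets_val ((a @ b) # C)]
        (sets_val (groups D ((a @ b) # C))) ((length D + 1) * K)"
      by (rule "4.IH") (use 4 in auto)
    have "computes P APPEND [nats_val a, nats_val b] (nats_val (a @ b)) (lin N)"
      using 4 by (intro append_computes) simp
    note calls = this IH[simplified]
    show ?case
      using calls[THEN run_time_le]
      by (intro computesI)
        (simp_all add: program_with_main_def groups_body_def calls[THEN wp_call_iff] K_def[symmetric],
         simp add: K_def)
  qed
  then show ?thesis
    by (rule computes_mono) (use assms(2) in \<open>simp add: groups_cost_def K_def\<close>)
qed

lemma add_groups_computes:
  assumes "\<And>g. g \<in> set gs \<Longrightarrow> length g \<le> N" "length gs \<le> N" "length es \<le> N" "length (fst st) \<le> N"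
  shows "computes P ADD_GROUPS [sets_val gs, pairs_val es, state_val st]
    (state_val (add_groups gs es st)) (add_groups_cost N)"
proof -
  define K where "K = inside_cost N + kruskal_cost N + 60"
  have "computes P ADD_GROUPS [sets_val gs, pairs_val es, state_val st]
    (state_val (add_groups gs es st)) ((length gs + 1) * K)"
    using assms(1,4)
  proof (induction gs arbitrary: st)
    case Nil
    show ?case by (rule computesI) (simp_all add: program_with_main_def add_groups_body_def K_def)
  next
    case (Cons g gs)
    have "length (inside g es) \<le> N" using length_inside[of g es] assms(3) by simp
    note kr = kruskal_computes[OF Cons.prems(2) this]
    have ins: "computes P INSIDE [nats_val g, pairs_val es] (pairs_val (inside g es)) (inside_cost N)"
      using Cons.prems(1) assms(3) by (intro inside_computes) auto
    have IH: "computes P ADD_GROUPS [sets_val gs, pairs_val es, state_val (kruskal (inside g es) st)]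
        (state_val (add_groups gs es (kruskal (inside g es) st))) ((length gs + 1) * K)"
      by (rule Cons.IH) (use Cons.prems in auto)
    note calls = ins kr IH
    show ?case
      using calls[THEN run_time_le]
      by (intro computesI)
        (simp_all add: program_with_main_def add_groups_body_def calls[THEN wp_call_iff] K_def[symmetric],
         simp add: K_def)
  qed
  then show ?thesis
    by (rule computes_mono) (use assms(2) in \<open>simp add: add_groups_cost_def K_def\<close>)
qed

text \<open>\<open>3 \<le> N\<close> covers the list \<open>[t0, s, t]\<close> passed to
  \<open>INSIDE\<close>.\<close>

lemma connect_computes:
  assumes "length ss \<le> N" "length es \<le> N" "length (fst st) \<le> N" "3 \<le> N"
  shows "computes P CONNECT [NatV t0, NatV t, nats_val ss, pairs_val es, state_val st]
    (state_val (connect t0 t ss es st)) (connect_cost N)"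
proof -
  define K where "K = inside_cost N + kruskal_cost N + 2 * lin N + 60"
  have "computes P CONNECT [NatV t0, NatV t, nats_val ss, pairs_val es, state_val st]
    (state_val (connect t0 t ss es st)) ((length ss + 1) * K)"
  proof (induction ss)
    case Nil
    show ?case by (rule computesI) (simp_all add: program_with_main_def connect_body_def K_def)
  next
    case (Cons s ss)
    let ?k = "kruskal (inside [t0, s, t] es) st"
    have k: "length (fst ?k) \<le> N" "length (inside [t0, s, t] es) \<le> N"
      using assms length_inside[of "[t0, s, t]" es] by simp_all
    have "computes P INSIDE [nats_val [t0, s, t], pairs_val es]
        (pairs_val (inside [t0, s, t] es)) (inside_cost N)"
      using assms by (intro inside_computes) auto
    note calls = this[simplified] kruskal_computes[OF assms(3) k(2)] Cons.IH
      lookup_computes[OF k(1), of t0] lookup_computes[OF k(1), of t]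
    show ?case
      using calls[THEN run_time_le]
      by (intro computesI)
        (simp_all add: program_with_main_def connect_body_def calls[THEN wp_call_iff] K_def[symmetric]
          Let_def, auto simp: K_def)
  qed
  then show ?thesis
    by (rule computes_mono) (use assms(1) in \<open>simp add: connect_cost_def K_def\<close>)
qed

lemma attach_computes:
  assumes "length ts \<le> N" "length ss \<le> N" "length es \<le> N" "length (fst st) \<le> N" "3 \<le> N"
  shows "computes P ATTACH [NatV t0, nats_val ts, nats_val ss, pairs_val es, state_val st]
    (state_val (attach t0 ts ss es st)) (attach_cost N)"
proof -
  define K where "K = connect_cost N + 2 * lin N + 60"
  have "computes P ATTACH [NatV t0, nats_val ts, nats_val ss, pairs_val es, state_val st]
    (state_val (attach t0 ts ss es st)) ((length ts + 1) * K)"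
    using assms(4)
  proof (induction ts arbitrary: st)
    case Nil
    show ?case by (rule computesI) (simp_all add: program_with_main_def attach_body_def K_def)
  next
    case (Cons t ts)
    note IH = Cons.IH[OF Cons.prems]
    have IH': "computes P ATTACH
        [NatV t0, nats_val ts, nats_val ss, pairs_val es, state_val (connect t0 t ss es st)]
        (state_val (attach t0 ts ss es (connect t0 t ss es st))) ((length ts + 1) * K)"
      by (rule Cons.IH) (use Cons.prems in auto)
    note calls = IH IH' connect_computes[OF assms(2,3) Cons.prems assms(5), of t0 t]
      lookup_computes[OF Cons.prems, of t0] lookup_computes[OF Cons.prems, of t]
    show ?case
      using calls[THEN run_time_le]
      by (intro computesI)
        (simp_all add: program_with_main_def attach_body_def calls[THEN wp_call_iff] K_def[symmetric],
          auto simp: K_def)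
  qed
  then show ?thesis
    by (rule computes_mono) (use assms(1) in \<open>simp add: attach_cost_def K_def\<close>)
qed

lemma diff_computes:
  assumes "length vs \<le> N" "length T \<le> N"
  shows "computes P DIFF [nats_val vs, nats_val T] (nats_val (diff vs T)) (diff_cost N)"
proof -
  define K where "K = lin N + 40"
  have "computes P DIFF [nats_val vs, nats_val T] (nats_val (diff vs T)) ((length vs + 1) * K)"
  proof (induction vs)
    case Nil
    show ?case by (rule computesI) (simp_all add: program_with_main_def diff_body_def diff_def K_def)
  next
    case (Cons v vs)
    note calls = Cons.IH mem_computes[OF assms(2), of v]
    show ?case
      using calls[THEN run_time_le]
      by (intro computesI)
        (auto simp: program_with_main_def diff_body_def calls[THEN wp_call_iff] K_def[symmetric]
          diff_def, auto simp: K_def)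
  qed
  then show ?thesis
    by (rule computes_mono) (use assms(1) in \<open>simp add: diff_cost_def K_def\<close>)
qed

lemma complete_computes:
  assumes "T \<noteq> []" "length X \<le> N" "length T \<le> N" "length ss \<le> N" "length vs \<le> N"
    "length es \<le> N" "3 \<le> N"
  shows "computes P COMPLETE [nats_val X, nats_val T, nats_val ss, nats_val vs, pairs_val es]
    (pairs_val (complete X T ss vs es)) (complete_cost N)"
proof -
  obtain t T' where T: "T = t # T'" using assms(1) by (cases T) auto
  let ?k = "kruskal (inside (T @ X) es) (singletons vs, [])"
  have k: "length (fst ?k) \<le> N" "length (singletons vs) \<le> N" "length (inside (T @ X) es) \<le> N"
    using assms length_inside[of "T @ X" es] by (simp_all add: singletons_def)
  have "computes P KRUSKAL [pairs_val (inside (T @ X) es), state_val (singletons vs, [])]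
      (state_val ?k) (kruskal_cost N)"
    by (rule kruskal_computes) (use k in auto)
  moreover have "computes P INSIDE [nats_val (T @ X), pairs_val es] (pairs_val (inside (T @ X) es))
      (inside_cost (2 * N))"
    using assms by (intro inside_computes) auto
  ultimately have
    "computes P KRUSKAL [pairs_val (inside (T @ X) es), PairV (pairs_val (singletons vs)) (NatV 0)]
      (state_val ?k) (kruskal_cost N)"
    "computes P INSIDE [nats_val (T @ X), pairs_val es] (pairs_val (inside (T @ X) es))
      (inside_cost (2 * N))" by simp_all
  note calls = this singletons_computes[OF assms(5)] append_computes[OF assms(3), of X]
    attach_computes[OF assms(3,4,6) k(1) assms(7), of t]
  note calls = calls[unfolded T, simplified]
  show ?thesis
    using calls[THEN run_time_le]
    by (intro computesI) (simp_all add: program_with_main_def complete_body_def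
        calls[THEN wp_call_iff] complete_cost_def complete_def T)
qed

text \<open>A taken candidate moves from \<open>rs\<close> to \<open>X\<close>, so the sum of the
  two lengths never grows. The assumption \<open>short\<close> bounds the lists whose lengths are
  compared at each branching.\<close>

lemma search_computes:
  assumes T: "T \<noteq> []" "length T \<le> N" and N: "length ss \<le> N" "length vs \<le> N" "length es \<le> N" "3 \<le> N"
    and short: "\<And>X. length (complete X T ss vs es) \<le> N" and X: "length X + length rs \<le> N"
  shows "computes P SEARCH [nats_val rs, NatV q, nats_val X, nats_val T, nats_val ss, nats_val vs,
      pairs_val es] (pairs_val (search rs q X T ss vs es)) (search_cost q N)"
proof -
  define K where "K = complete_cost N + 2 * lin N + 80"
  have "computes P SEARCH [nats_val rs, NatV q, nats_val X, nats_val T, nats_val ss, nats_val vs,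
      pairs_val es] (pairs_val (search rs q X T ss vs es)) (search_nodes (length rs) q * K)"
    using X
  proof (induction rs arbitrary: q X)
    case Nil
    then have call: "computes P COMPLETE [nats_val X, nats_val T, nats_val ss, nats_val vs, pairs_val es]
        (pairs_val (complete X T ss vs es)) (complete_cost N)"
      using T N by (intro complete_computes) auto
    show ?case
      using run_time_le[OF call]
      by (intro computesI)
        (simp_all add: program_with_main_def search_body_def Let_def wp_call_iff[OF call] K_def)
  next
    case (Cons s rs)
    show ?case
    proof (cases q)
      case 0
      have call: "computes P COMPLETE [nats_val X, nats_val T, nats_val ss, nats_val vs, pairs_val es]
          (pairs_val (complete X T ss vs es)) (complete_cost N)"
        using T N Cons.prems by (intro complete_computes) auto
      show ?thesis
        using run_time_le[OF call] 0
        by (intro computesI)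
          (simp_all add: program_with_main_def search_body_def Let_def wp_call_iff[OF call] K_def)
    next
      case (Suc r)
      let ?a = "search rs (Suc r) X T ss vs es" and ?b = "search rs r (s # X) T ss vs es"
      have "length ?a \<le> N" using search_complete[of X rs "Suc r" T ss vs es] short by auto
      note a = length_computes[OF this]
      have "length ?b \<le> N" using search_complete[of "s # X" rs r T ss vs es] short by auto
      note b = length_computes[OF this]
      have IH1: "computes P SEARCH [nats_val rs, NatV (Suc r), nats_val X, nats_val T, nats_val ss,
          nats_val vs, pairs_val es] (pairs_val ?a) (search_nodes (length rs) (Suc r) * K)"
        by (rule Cons.IH) (use Cons.prems in auto)
      have IH2: "computes P SEARCH [nats_val rs, NatV r, nats_val (s # X), nats_val T, nats_val ss,
          nats_val vs, pairs_val es] (pairs_val ?b) (search_nodes (length rs) r * K)"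
        by (rule Cons.IH) (use Cons.prems in auto)
      note calls = IH1 IH2[simplified] a b
      show ?thesis
        using calls[THEN run_time_le] unfolding Suc
        by (intro computesI)
          (simp_all add: program_with_main_def search_body_def Let_def calls[THEN wp_call_iff]
            shorter_def add_mult_distrib, auto simp: K_def)
    qed
  qed
  moreover have "search_nodes (length rs) q * K \<le> search_cost q N"
  proof -
    have "search_nodes (length rs) q \<le> 2 * (length rs + 1) ^ q"
      using search_nodes_le[of "length rs" q] by linarith
    also have "\<dots> \<le> 2 * (N + 1) ^ q" using X by (intro mult_le_mono2 power_mono) auto
    finally show ?thesis unfolding search_cost_def K_def by (simp add: mult.commute)
  qed
  ultimately show ?thesis by (rule computes_mono)
qed

lemma grouped_computes:
  assumes "\<And>a. a \<in> set D \<Longrightarrow> length a \<le> N" "length D \<le> N"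
    "\<And>g. g \<in> set (groups D C) \<Longrightarrow> length g \<le> N" "length (groups D C) \<le> N"
    "length vs \<le> N" "length es \<le> N"
  shows "computes P GROUPED
    [PairV (sets_val D) (sets_val C), PairV (nats_val vs) (PairV (pairs_val es) w)]
    (pairs_val (snd (add_groups (groups D C) es (singletons vs, [])))) (grouped_cost N)"
proof -
  have "computes P ADD_GROUPS [sets_val (groups D C), pairs_val es, state_val (singletons vs, [])]
      (state_val (add_groups (groups D C) es (singletons vs, []))) (add_groups_cost N)"
    using assms by (intro add_groups_computes) (auto simp: singletons_def)
  note calls = groups_computes[OF assms(1,2), of C] singletons_computes[OF assms(5)] this[simplified]
  show ?thesis
    using calls[THEN run_time_le]
    by (intro computesI) (simp_all add: program_with_main_def grouped_body_def
        calls[THEN wp_call_iff] grouped_cost_def)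
qed

text \<open>\<open>graph_lists vs es\<close> provides the invariant that bounds every candidate
  solution by the number of edges.\<close>

lemma solve_computes:
  assumes "graph_lists vs es" "length vs \<le> N" "length es \<le> N" "length ts \<le> N"
    "length (concat ts) \<le> N" "3 \<le> N"
  shows "computes P SOLVE [NatV q, PairV (nats_val vs) (PairV (pairs_val es) (sets_val ts))]
    (pairs_val (solve q vs es ts)) (solve_cost q N)"
proof -
  interpret graph_lists vs es by (rule assms(1))
  define D where "D = disconnected_sets vs es ts"
  define C where "C = connected_sets vs es ts"
  have ts: "length T \<le> N" if "T \<in> set ts" for T
    using length_le_concat[OF that] assms(5) by simp
  have D: "length T \<le> N" if "T \<in> set D" for T using that ts by (auto simp: D_def disconnected_sets_def)
  have DC: "length D \<le> N" "length (groups D C) \<le> N" "length (concat (groups D C)) \<le> N"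
    using length_sets[of vs es ts] length_groups_le[of D C] length_concat_groups[of D C]
      length_concat_sets[of vs es ts] assms(4,5) unfolding D_def C_def by linarith+
  have groups: "length g \<le> N" if "g \<in> set (groups D C)" for g
    using length_le_concat[OF that] DC(3) by simp
  note split = split_computes[OF assms(2,3) ts assms(4), folded D_def C_def]
  note grouped = grouped_computes[OF D DC(1) groups DC(2) assms(2,3), of "sets_val ts"]
  have solve: "solve q vs es ts = (if length D = 1 \<and> C = []
      then search (diff vs (hd D)) q [] (hd D) (diff vs (hd D)) vs es
      else snd (add_groups (groups D C) es (singletons vs, [])))"
    by (simp add: solve_def D_def C_def Let_def)
  show ?thesis
  proof (cases "length D = 1 \<and> C = []")
    case True
    then obtain T where DT: "D = [T]" by (auto simp: length_Suc_conv)
    let ?S = "diff vs T"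
    have T: "T \<noteq> []" "length T \<le> N" using DT D[of T] by (auto simp: D_def disconnected_sets_def
          dest!: arg_cong[of _ _ set])
    have S: "length ?S \<le> N" unfolding diff_def using assms(2) length_filter_le le_trans by blast
    have short: "length (complete X T ?S vs es) \<le> N" for X
    proof -
      obtain L where L: "kinv (L, complete X T ?S vs es)" using kinv_complete by blast
      then show ?thesis using kinv_length_le[OF L] assms(3) by simp
    qed
    have "computes P SEARCH [nats_val ?S, NatV q, nats_val [], nats_val T, nats_val ?S, nats_val vs,
      pairs_val es] (pairs_val (search ?S q [] T ?S vs es)) (search_cost q N)"
      using T S assms short by (intro search_computes) auto
    note calls = this[simplified] split[unfolded DT, simplified] diff_computes[OF assms(2) T(2)]
    show ?thesis
      using calls[THEN run_time_le] True
      by (intro computesI) (simp_all add: program_with_main_def solve_body_def Let_def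
          calls[THEN wp_call_iff] solve_cost_def solve DT)
  next
    case False
    have res: "solve q vs es ts = snd (add_groups (groups D C) es (singletons vs, []))"
      unfolding solve using False by (rule if_not_P)
    note calls = split grouped
    consider "D = []" | T where "D = [T]" "C \<noteq> []" | T T' D' where "D = T # T' # D'"
      using False by (metis One_nat_def length_Cons list.exhaust list.size(3))
    then show ?thesis
    proof cases
      case 1
      then show ?thesis
        using calls[THEN run_time_le] unfolding res
        by (intro computesI) (simp_all add: program_with_main_def solve_body_def Let_def
            calls[unfolded 1, simplified, THEN wp_call_iff] solve_cost_def)
    next
      case 2
      then obtain c C' where C: "C = c # C'" by (cases C) auto
      show ?thesis
        using calls[THEN run_time_le] unfolding res
        by (intro computesI) (simp_all add: program_with_main_def solve_body_def Let_def
            calls[unfolded 2 C, simplified, THEN wp_call_iff] solve_cost_def 2 C)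
    next
      case 3
      then show ?thesis
        using calls[THEN run_time_le] unfolding res
        by (intro computesI) (simp_all add: program_with_main_def solve_body_def Let_def
            calls[unfolded 3, simplified, THEN wp_call_iff] solve_cost_def)
    qed
  qed
qed

end

section \<open>Polynomial running time\<close>

text \<open>Feasible instances without Steiner nodes never reach the search; budget 0 keeps it cheap
  on the infeasible ones.\<close>

definition exact_main :: exp where
  "exact_main = Call SOLVE [Lit 0, Var 0]"

text \<open>The budget \<open>200 * n * n\<close> is determined by the accuracy, so for fixed
  \<open>n\<close> its computation takes constant time.\<close>

definition approximation_main :: exp where
  "approximation_main = Call SOLVE
     [Call MUL [Call MUL [Lit 200, Snd (Fst (Var 0))], Snd (Fst (Var 0))], Snd (Var 0)]"

lemma runs_of_wp:
  assumes "wp (program_with_main main) [x] main (\<lambda>w t. w = y \<and> t \<le> b)"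
  shows "\<exists>t. runs (program_with_main main) x y t \<and> t \<le> b + val_size y"
  using assms by (force simp: wp_def runs_def program_with_main_def)

lemma val_size_list_val:
  "val_size (list_val f xs) = 1 + (\<Sum>x\<leftarrow>xs. val_size (f x) + 1)"
  by (induction xs) (auto simp: floorlog_def)

lemma length_le_val_size: "length xs \<le> val_size (list_val f xs)"
  by (induction xs) auto

lemma length_concat_le_val_size: "length (concat xs) \<le> val_size (list_val (list_val f) xs)"
proof (induction xs)
  case (Cons x xs)
  then show ?case using length_le_val_size[of x f] by simp
qed simp

lemma val_size_mem_le: "x \<in> set xs \<Longrightarrow> val_size (f x) \<le> val_size (list_val f xs)"
  by (induction xs) auto

lemma val_size_list_val_le:
  assumes "\<And>x. x \<in> set xs \<Longrightarrow> val_size (f x) \<le> N" "length xs \<le> N"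
  shows "val_size (list_val f xs) \<le> 1 + N * (N + 1)"
proof -
  have "(\<Sum>x\<leftarrow>xs. val_size (f x) + 1) \<le> (\<Sum>x\<leftarrow>xs. N + 1)"
    by (rule sum_list_mono) (use assms(1) in auto)
  also have "\<dots> = length xs * (N + 1)" by (simp add: sum_list_triv)
  also have "\<dots> \<le> N * (N + 1)" by (rule mult_le_mono1[OF assms(2)])
  finally show ?thesis by (simp add: val_size_list_val)
qed

text \<open>The output consists of entries of the input edge list and is no longer than it, so a
  quadratic bound suffices.\<close>

lemma (in graph_lists) val_size_solve_le:
  assumes "val_size (pairs_val es) \<le> N"
  shows "val_size (pairs_val (solve q vs es ts)) \<le> 1 + N * (N + 1)"
proof (rule val_size_list_val_le)
  show "val_size (pair_val e) \<le> N" if "e \<in> set (solve q vs es ts)" for e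
    using that solve_subset val_size_mem_le[of e es pair_val] assms by fastforce
  show "length (solve q vs es ts) \<le> N"
    using length_solve_le[of q ts] length_le_val_size[of es pair_val] assms by linarith
qed

section \<open>Functions bounded by polynomials\<close>

definition poly_bounded :: "(nat \<Rightarrow> nat) \<Rightarrow> bool" where
  "poly_bounded f \<longleftrightarrow> (\<exists>b :: nat poly. \<forall>n. f n \<le> poly b n)"

lemma poly_bounded_const: "poly_bounded (\<lambda>n. c)"
  unfolding poly_bounded_def by (rule exI[of _ "[:c:]"]) simp

lemma poly_bounded_id: "poly_bounded (\<lambda>n. n)"
  unfolding poly_bounded_def by (rule exI[of _ "[:0, 1:]"]) simp

lemma poly_bounded_add:
  assumes "poly_bounded f" "poly_bounded g"
  shows "poly_bounded (\<lambda>n. f n + g n)"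
proof -
  obtain a b where "\<And>n. f n \<le> poly a n" "\<And>n. g n \<le> poly b n"
    using assms by (auto simp: poly_bounded_def)
  then show ?thesis unfolding poly_bounded_def by (intro exI[of _ "a + b"]) (simp add: add_mono)
qed

lemma poly_bounded_mult:
  assumes "poly_bounded f" "poly_bounded g"
  shows "poly_bounded (\<lambda>n. f n * g n)"
proof -
  obtain a b where "\<And>n. f n \<le> poly a n" "\<And>n. g n \<le> poly b n"
    using assms by (auto simp: poly_bounded_def)
  then show ?thesis unfolding poly_bounded_def by (intro exI[of _ "a * b"]) (simp add: mult_le_mono)
qed

lemma poly_bounded_power: "poly_bounded f \<Longrightarrow> poly_bounded (\<lambda>n. f n ^ k)"
  by (induction k) (simp_all add: poly_bounded_const poly_bounded_mult)

text \<open>For a fixed budget \<open>q\<close> the factor \<open>(N + 1) ^ q\<close> of the search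
  is a polynomial in \<open>N\<close>.\<close>

lemma poly_bounded_solve_cost: "poly_bounded (solve_cost q)"
  unfolding solve_cost_def split_cost_def grouped_cost_def diff_cost_def search_cost_def
    complete_cost_def attach_cost_def connect_cost_def add_groups_cost_def groups_cost_def
    connected_cost_def label_cost_def kruskal_cost_def inside_cost_def lin_def
  by (intro poly_bounded_add poly_bounded_mult poly_bounded_power poly_bounded_const poly_bounded_id)

definition total_cost :: "nat \<Rightarrow> nat \<Rightarrow> nat" where
  "total_cost q N = solve_cost q N + N * (N + 1)"

lemma poly_bounded_total_cost: "poly_bounded (\<lambda>N. total_cost q N + c)"
  unfolding total_cost_def
  by (intro poly_bounded_add poly_bounded_mult poly_bounded_const poly_bounded_id
      poly_bounded_solve_cost)

lemma pair_val_eq: "(\<lambda>(u, v). PairV (NatV u) (NatV v)) = pair_val"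
  by auto

lemma instance_encodingE:
  assumes "instance_encoding x I" "sf_instance I"
  obtains vs es ts where "encoded_instance I vs es ts"
    "x = PairV (nats_val vs) (PairV (pairs_val es) (sets_val ts))"
  using assms unfolding instance_encoding_def edges_encoding_def encoded_instance_def pair_val_eq
  by blast

context encoded_instance
begin

abbreviation "input \<equiv> PairV (nats_val vs) (PairV (pairs_val es) (sets_val ts))"

lemma solve_computes_input:
  "computes (program_with_main main) SOLVE [NatV q, input] (pairs_val (solve q vs es ts))
     (solve_cost q (val_size input))"
proof (rule solve_computes)
  show "length vs \<le> val_size input" using length_le_val_size[of vs NatV] by simp
  show "length es \<le> val_size input" using length_le_val_size[of es pair_val] by simp
  show "length ts \<le> val_size input" using length_le_val_size[of ts "nats_val"] by simp
  show "length (concat ts) \<le> val_size input" using length_concat_le_val_size[of ts NatV] by simp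
  \<comment> \<open>Each encoded list has size at least 1, which yields the bound 3 needed for the
    three-element lists of \<open>connect\<close>.\<close>
  have "1 \<le> val_size (list_val f xs)" for f :: "'b \<Rightarrow> val" and xs by (simp add: val_size_list_val)
  from this[of NatV vs] this[of pair_val es] show "3 \<le> val_size input" by simp
qed (rule graph_lists_axioms)

lemma val_size_output:
  "val_size (pairs_val (solve q vs es ts)) \<le> 1 + val_size input * (val_size input + 1)"
  by (rule val_size_solve_le) simp

lemma exact_program_runs:
  "\<exists>t. runs (program_with_main exact_main) input (pairs_val (solve 0 vs es ts)) t \<and>
     t \<le> total_cost 0 (val_size input) + 10"
proof -
  have "wp (program_with_main main) [input] exact_main
    (\<lambda>w t. w = pairs_val (solve 0 vs es ts) \<and> t \<le> solve_cost 0 (val_size input) + 5)" for main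
    using run_time_le[OF solve_computes_input[of main 0]]
    by (simp add: exact_main_def wp_call_iff[OF solve_computes_input])
  from runs_of_wp[OF this] show ?thesis
    using val_size_output[of 0] unfolding total_cost_def by fastforce
qed

text \<open>The additive term pays for the two multiplications, of about \<open>30 * 200\<close> and
  \<open>30 * 200 * n\<close> steps; it is constant for fixed \<open>n\<close>.\<close>

lemma approximation_program_runs:
  "\<exists>t. runs (program_with_main approximation_main) (PairV (PairV (NatV m) (NatV n)) input)
       (pairs_val (solve (200 * n * n) vs es ts)) t \<and>
     t \<le> total_cost (200 * n * n) (val_size input) + (6000 * n + 7000)"
proof -
  have "wp (program_with_main main) [PairV (PairV (NatV m) (NatV n)) input] approximation_main
    (\<lambda>w t. w = pairs_val (solve (200 * n * n) vs es ts) \<and>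
      t \<le> solve_cost (200 * n * n) (val_size input) + (6000 * n + 6500))" for main
  proof -
    note calls = solve_computes_input[of main "200 * n * n"] mul_computes[of main 200 n]
      mul_computes[of main "200 * n" n]
    show ?thesis
      using calls[THEN run_time_le] by (simp add: approximation_main_def calls[THEN wp_call_iff])
  qed
  from runs_of_wp[OF this] show ?thesis
    using val_size_output[of "200 * n * n"] unfolding total_cost_def by fastforce
qed

end

section \<open>The approximation scheme and the exact algorithm\<close>

lemma ptas_dense:
  assumes "\<delta> > 1 / 2"
  shows "ptas_on (pairwise_dense \<delta>)"
  unfolding ptas_on_def
proof (intro exI[of _ "program_with_main approximation_main"] allI impI)
  fix m n :: nat
  assume mn: "m > 0 \<and> n > 0"
  obtain b :: "nat poly" where
    b: "\<And>N. total_cost (200 * n * n) N + (6000 * n + 7000) \<le> poly b N"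
    using poly_bounded_total_cost unfolding poly_bounded_def by meson
  show "\<exists>b :: nat poly. \<forall>I x. sf_instance I \<and> pairwise_dense \<delta> I \<and> instance_encoding x I \<longrightarrow>
    (\<exists>y t. runs (program_with_main approximation_main) (PairV (PairV (NatV m) (NatV n)) x) y t \<and>
      t \<le> poly b (val_size x) \<and>
      (feasible I \<longrightarrow> (\<exists>F. edges_encoding y F \<and> steiner_forest I F \<and>
        real (card F) \<le> (1 + real m / real n) * real (opt_size I))))"
  proof (intro exI[of _ b] allI impI, elim conjE)
    fix I x
    assume I: "sf_instance I" and dense: "pairwise_dense \<delta> I" and x: "instance_encoding x I"
    obtain vs es ts where enc: "encoded_instance I vs es ts"
      and x_eq: "x = PairV (nats_val vs) (PairV (pairs_val es) (sets_val ts))"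
      using x I by (rule instance_encodingE)
    interpret encoded_instance I vs es ts by (rule enc)
    interpret dense_instance I vs es ts \<delta> by unfold_locales (use dense assms in auto)
    let ?F = "solve (200 * n * n) vs es ts"
    obtain t where t: "runs (program_with_main approximation_main)
        (PairV (PairV (NatV m) (NatV n)) x) (pairs_val ?F) t"
      "t \<le> total_cost (200 * n * n) (val_size x) + (6000 * n + 7000)"
      using approximation_program_runs x_eq by blast
    have "\<exists>F. edges_encoding (pairs_val ?F) F \<and> steiner_forest I F \<and>
        real (card F) \<le> (1 + real m / real n) * real (opt_size I)" if feas: "feasible I"
    proof (intro exI[of _ "uedges ?F"] conjI)
      note correct = solve_correct[OF feas, of n]
      show "edges_encoding (pairs_val ?F) (uedges ?F)"
        using correct(1) mn unfolding edges_encoding_def pair_val_eq by blast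
      show "steiner_forest I (uedges ?F)" using correct(2) mn by blast
      have "n * card (uedges ?F) \<le> (n + 1) * opt_size I" using correct(3) mn by blast
      \<comment> \<open>The computed solution has ratio \<open>1 + 1 / n\<close>, which is good
        enough since \<open>m\<close> is at least 1.\<close>
      also have "\<dots> \<le> (n + m) * opt_size I" using mn by (intro mult_le_mono1) simp
      finally have "real (n * card (uedges ?F)) \<le> real ((n + m) * opt_size I)"
        by (simp only: of_nat_le_iff)
      then show "real (card (uedges ?F)) \<le> (1 + real m / real n) * real (opt_size I)"
        using mn by (simp add: field_simps)
    qed
    then show "\<exists>y t. runs (program_with_main approximation_main) (PairV (PairV (NatV m) (NatV n)) x) y t \<and>
      t \<le> poly b (val_size x) \<and>
      (feasible I \<longrightarrow> (\<exists>F. edges_encoding y F \<and> steiner_forest I F \<and>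
        real (card F) \<le> (1 + real m / real n) * real (opt_size I)))"
      using t b le_trans by blast
  qed
qed

lemma exact_dense_without_steiner_nodes:
  assumes "\<delta> > 1 / 2"
  shows "polytime_solvable_on (\<lambda>I. pairwise_dense \<delta> I \<and> steiner_nodes I = {})"
  unfolding polytime_solvable_on_def
proof -
  obtain b :: "nat poly" where b: "\<And>N. total_cost 0 N + 10 \<le> poly b N"
    using poly_bounded_total_cost unfolding poly_bounded_def by meson
  show "\<exists>p (b :: nat poly). \<forall>I x.
    sf_instance I \<and> (pairwise_dense \<delta> I \<and> steiner_nodes I = {}) \<and> instance_encoding x I \<longrightarrow>
    (\<exists>y t. runs p x y t \<and> t \<le> poly b (val_size x) \<and>
      (feasible I \<longrightarrow> (\<exists>F. edges_encoding y F \<and> steiner_forest I F \<and> card F = opt_size I)))"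
  proof (intro exI[of _ "program_with_main exact_main"] exI[of _ b] allI impI, elim conjE)
    fix I x
    assume I: "sf_instance I" and dense: "pairwise_dense \<delta> I" and S: "steiner_nodes I = {}"
      and x: "instance_encoding x I"
    obtain vs es ts where enc: "encoded_instance I vs es ts"
      and x_eq: "x = PairV (nats_val vs) (PairV (pairs_val es) (sets_val ts))"
      using x I by (rule instance_encodingE)
    interpret encoded_instance I vs es ts by (rule enc)
    interpret dense_instance I vs es ts \<delta> by unfold_locales (use dense assms in auto)
    let ?F = "solve 0 vs es ts"
    obtain t where t: "runs (program_with_main exact_main) x (pairs_val ?F) t"
      "t \<le> total_cost 0 (val_size x) + 10"
      using exact_program_runs x_eq by blast
    have "\<exists>F. edges_encoding (pairs_val ?F) F \<and> steiner_forest I F \<and> card F = opt_size I"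
      if feas: "feasible I"
      using solve_exact[OF feas S, of 0] unfolding edges_encoding_def pair_val_eq by blast
    then show "\<exists>y t. runs (program_with_main exact_main) x y t \<and> t \<le> poly b (val_size x) \<and>
      (feasible I \<longrightarrow> (\<exists>F. edges_encoding y F \<and> steiner_forest I F \<and> card F = opt_size I))"
      using t b le_trans by blast
  qed
qed

theorem theorem1:
  fixes \<delta> :: real
  assumes "\<delta> > 1 / 2"
  shows "ptas_on (pairwise_dense \<delta>) \<and>
         polytime_solvable_on (\<lambda>I. pairwise_dense \<delta> I \<and> steiner_nodes I = {})"
  using ptas_dense[OF assms] exact_dense_without_steiner_nodes[OF assms] by blast

end
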